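(* Let $A\in\mathbb{C}^{n\times n}$. Then $\delta(A)=\sigma(A)$ if and only if $A$ has a singular value decomposition $A=U\Sigma V^*$ with $U,V\in\mathbf{U}(n)$ such that the diagonal of $U^*V$ is zero, i.e. $\langle u_i,v_i\rangle=0$ for $i=1,\dots,n$, where $u_i,v_i$ are the $i$-th columns of $U$ and $V$.
   Context: $n\ge 2$. $\mathbf{U}(n)$ is the set of $n\times n$ unitary matrices; $\sigma(A)=(\sigma_1(A),\dots,\sigma_n(A))$ is the vector of singular values of $A$ in decreasing order. For $A\in\mathbb{C}^{n\times n}$ and $1\le k\le n$ the $k$-th discrepancy seminorm is $$\|A\|^{\delta}_{(k)}=\max\Big|\sum_{i=1}^k\langle Ax_i,y_i\rangle\Big|,$$ the maximum being over all pairs of orthonormal families $\{x_j\}_{j=1}^k$, $\{y_j\}_{j=1}^k$ in $\mathbb{C}^n$ with $\sum_{j=1}^k\langle x_j,y_j\rangle=0$; also $\|A\|^{\delta}_{(0)}=0$. The $k$-th discrepancy value is $\delta_k(A)=\|A\|^{\delta}_{(k)}-\|A\|^{\delta}_{(k-1)}$, and $\delta(A)=(\delta_1(A),\dots,\delta_n(A))$ (decreasingly sorted). *)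

theory Defs
  imports
    "HOL-Analysis.Analysis"
    "HOL-Library.Multiset"
    "HOL-Computational_Algebra.Polynomial"
    "Jordan_Normal_Form.Char_Poly"
    "Jordan_Normal_Form.Schur_Decomposition"
begin

text \<open>Indices are 0-based throughout: families, list entries and matrix entries are numbered
  \<open>0, \<dots>, n - 1\<close>, while the seminorms keep their usual parameter \<open>k \<in> {0, \<dots>, n}\<close>.
  The inner product is \<open>x \<bullet>c y\<close>, linear in \<open>x\<close>.\<close>

definition unitary_group :: "nat \<Rightarrow> complex mat set" where
  "unitary_group n =
     {U \<in> carrier_mat n n. U * mat_adjoint U = 1\<^sub>m n \<and> mat_adjoint U * U = 1\<^sub>m n}"

text \<open>The square roots of the eigenvalues of \<open>A\<^sup>* A\<close>, with multiplicity, in decreasing order.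
  These eigenvalues are real and nonnegative, so taking \<open>Re\<close> loses nothing.\<close>

definition singular_values :: "complex mat \<Rightarrow> real list" where
  "singular_values A =
     rev (sorted_list_of_multiset
       (image_mset (\<lambda>z. sqrt (Re z)) (proots (char_poly (mat_adjoint A * A)))))"

definition orthonormal_family :: "nat \<Rightarrow> nat \<Rightarrow> (nat \<Rightarrow> complex vec) \<Rightarrow> bool" where
  "orthonormal_family n k x \<longleftrightarrow>
     (\<forall>i<k. x i \<in> carrier_vec n) \<and>
     (\<forall>i<k. \<forall>j<k. x i \<bullet>c x j = (if i = j then 1 else 0))"

text \<open>The supremum below is a maximum for \<open>n \<ge> 2\<close> and \<open>1 \<le> k \<le> n\<close>: the set is a nonempty compact
  set of reals. For \<open>n = k = 1\<close> no admissible pair of families exists.\<close>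

definition discrepancy_seminorm :: "nat \<Rightarrow> complex mat \<Rightarrow> real" where
  "discrepancy_seminorm k A =
     (if k = 0 then 0
      else Sup {cmod (\<Sum>i<k. (A *\<^sub>v x i) \<bullet>c y i) | x y.
        orthonormal_family (dim_row A) k x \<and> orthonormal_family (dim_row A) k y \<and>
        (\<Sum>j<k. x j \<bullet>c y j) = 0})"

definition discrepancy_value :: "nat \<Rightarrow> complex mat \<Rightarrow> real" where
  "discrepancy_value k A = discrepancy_seminorm k A - discrepancy_seminorm (k - 1) A"

text \<open>The tuple \<open>(\<delta>\<^sub>1(A), \<dots>, \<delta>\<^sub>n(A))\<close> in the order of its index. It is decreasing because
  \<open>k \<mapsto> discrepancy_seminorm k A\<close> is concave, so no sorting is applied.\<close>

definition discrepancy_values :: "complex mat \<Rightarrow> real list" where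
  "discrepancy_values A = map (\<lambda>k. discrepancy_value k A) [1..<dim_row A + 1]"

definition is_SVD :: "complex mat \<Rightarrow> complex mat \<Rightarrow> complex mat \<Rightarrow> complex mat \<Rightarrow> bool" where
  "is_SVD A U S V \<longleftrightarrow>
     U \<in> unitary_group (dim_row A) \<and> V \<in> unitary_group (dim_row A) \<and>
     S = mat_diag (dim_row A) (\<lambda>i. complex_of_real (singular_values A ! i)) \<and>
     A = U * S * mat_adjoint V"

end

theory Submission
  imports Defs
begin

text \<open>
  By Ky Fan, \<open>\<delta>(A) = \<sigma>(A)\<close> means that for every \<open>k\<close> the bound
  \<open>\<bar>\<Sum>i<k. \<langle>A x\<^sub>i, y\<^sub>i\<rangle>\<bar> \<le> \<sigma>\<^sub>1 + \<dots> + \<sigma>\<^sub>k\<close> is attained under the constraint \<open>\<Sum>j<k. \<langle>x\<^sub>j, y\<^sub>j\<rangle> = 0\<close>.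
  The columns of \<open>V\<close> and \<open>U\<close> attain it when the diagonal of \<open>U\<^sup>*V\<close> vanishes.
  Conversely, the equality case for \<open>k = n\<close> yields a singular value decomposition in which \<open>U\<^sup>*V\<close> has
  trace zero; whenever \<open>\<sigma>\<^sub>k > \<sigma>\<^sub>k\<^sub>+\<^sub>1\<close>, the equality case for \<open>k\<close> shows that the first \<open>k\<close> diagonal
  entries of \<open>U\<^sup>*V\<close> sum to zero. So the diagonal blocks of \<open>U\<^sup>*V\<close> belonging to the distinct singular
  values have trace zero, and simultaneous rotations of both bases within the blocks make their
  diagonals constant, hence zero.

  Vectors of \<open>\<complex>\<^sup>n\<close> are functions on \<open>nat\<close> of which only the values below \<open>n\<close> matter; a matrix
  stands for the family of its columns, so \<open>u i l\<close> is the entry \<open>U $$ (l, i)\<close>.\<close>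

section \<open>Orthonormal families\<close>

definition cip :: "nat \<Rightarrow> (nat \<Rightarrow> complex) \<Rightarrow> (nat \<Rightarrow> complex) \<Rightarrow> complex" where
  "cip n f g = (\<Sum>l<n. f l * cnj (g l))"

definition ons :: "nat \<Rightarrow> nat \<Rightarrow> (nat \<Rightarrow> nat \<Rightarrow> complex) \<Rightarrow> bool" where
  "ons n k x \<longleftrightarrow> (\<forall>i<k. \<forall>j<k. cip n (x i) (x j) = (if i = j then 1 else 0))"

lemma onsD: "ons n k x \<Longrightarrow> i < k \<Longrightarrow> j < k \<Longrightarrow> cip n (x i) (x j) = (if i = j then 1 else 0)"
  by (simp add: ons_def)

lemma cip_cong:
  "(\<And>l. l < n \<Longrightarrow> f l = f' l) \<Longrightarrow> (\<And>l. l < n \<Longrightarrow> g l = g' l) \<Longrightarrow> cip n f g = cip n f' g'"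
  by (auto simp: cip_def intro!: sum.cong)

lemma cip_commute: "cip n g f = cnj (cip n f g)"
  by (simp add: cip_def mult.commute)

lemma mult_cnj_self: "z * cnj z = of_real ((cmod z)\<^sup>2)"
  by (rule complex_norm_square[symmetric])

lemma cip_self: "cip n f f = of_real (\<Sum>l<n. (cmod (f l))\<^sup>2)"
  unfolding cip_def by (simp add: mult_cnj_self)

lemma cip_add_left: "cip n (\<lambda>l. f l + f' l) g = cip n f g + cip n f' g"
  and cip_add_right: "cip n g (\<lambda>l. f l + f' l) = cip n g f + cip n g f'"
  and cip_scale_left: "cip n (\<lambda>l. c * f l) g = c * cip n f g"
  and cip_scale_right: "cip n g (\<lambda>l. c * f l) = cnj c * cip n g f"
  by (simp_all add: cip_def sum.distrib sum_distrib_left algebra_simps)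

lemma cip_sum_left: "cip n (\<lambda>l. \<Sum>i\<in>I. f i l) g = (\<Sum>i\<in>I. cip n (f i) g)"
  unfolding cip_def sum_distrib_right by (rule sum.swap)

lemma cip_sum_right: "cip n g (\<lambda>l. \<Sum>i\<in>I. f i l) = (\<Sum>i\<in>I. cip n g (f i))"
  unfolding cip_def cnj_sum sum_distrib_left by (rule sum.swap)

lemmas cip_linear = cip_add_left cip_add_right cip_scale_left cip_scale_right
  cip_sum_left cip_sum_right

text \<open>For an orthonormal family this is the \<open>l\<close>-th diagonal entry of the
  projection matrix onto its span, that is, the squared length of the projected \<open>l\<close>-th
  unit vector.\<close>

definition weight :: "nat \<Rightarrow> (nat \<Rightarrow> nat \<Rightarrow> complex) \<Rightarrow> nat \<Rightarrow> real" where
  "weight k x l = (\<Sum>i<k. (cmod (x i l))\<^sup>2)"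

definition gram :: "nat \<Rightarrow> (nat \<Rightarrow> nat \<Rightarrow> complex) \<Rightarrow> nat \<Rightarrow> nat \<Rightarrow> complex" where
  "gram k x l m = (\<Sum>i<k. x i l * cnj (x i m))"

lemma weight_nonneg: "weight k x l \<ge> 0"
  unfolding weight_def by (intro sum_nonneg) auto

lemma gram_diag: "gram k x l l = of_real (weight k x l)"
  unfolding gram_def weight_def by (simp add: mult_cnj_self)

text \<open>The trace of an orthogonal projection is its rank: exchanging the sums turns each member
  of the family into its squared norm 1.\<close>

lemma sum_weight:
  assumes "ons n k x"
  shows "(\<Sum>l<n. weight k x l) = real k"
proof -
  have "(\<Sum>l<n. weight k x l) = (\<Sum>i<k. \<Sum>l<n. (cmod (x i l))\<^sup>2)"
    unfolding weight_def by (rule sum.swap)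
  also have "\<dots> = (\<Sum>i<k. 1)"
  proof (rule sum.cong)
    fix i assume "i \<in> {..<k}"
    then have "cip n (x i) (x i) = 1" using onsD[OF assms] by simp
    then show "(\<Sum>l<n. (cmod (x i l))\<^sup>2) = 1" unfolding cip_self using of_real_eq_1_iff by blast
  qed simp
  finally show ?thesis by simp
qed

text \<open>\<open>gram k x\<close> is the orthogonal projection onto the span of the family; this is \<open>Q Q\<^sup>* = Q\<close>
  on the diagonal.\<close>

lemma gram_row_norm:
  assumes "ons n k x"
  shows "(\<Sum>m<n. (cmod (gram k x l m))\<^sup>2) = weight k x l"
proof -
  have "complex_of_real (\<Sum>m<n. (cmod (gram k x l m))\<^sup>2) = (\<Sum>m<n. gram k x l m * cnj (gram k x l m))"
    by (simp add: mult_cnj_self)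
  also have "\<dots> = (\<Sum>m<n. \<Sum>i<k. \<Sum>j<k. x i l * cnj (x j l) * (x j m * cnj (x i m)))"
    unfolding gram_def cnj_sum sum_product by (intro sum.cong refl) (simp add: mult_ac)
  also have "\<dots> = (\<Sum>i<k. \<Sum>m<n. \<Sum>j<k. x i l * cnj (x j l) * (x j m * cnj (x i m)))"
    by (rule sum.swap)
  also have "\<dots> = (\<Sum>i<k. \<Sum>j<k. \<Sum>m<n. x i l * cnj (x j l) * (x j m * cnj (x i m)))"
    by (rule sum.cong[OF refl], rule sum.swap)
  also have "\<dots> = (\<Sum>i<k. \<Sum>j<k. x i l * cnj (x j l) * cip n (x j) (x i))"
    by (simp add: cip_def sum_distrib_left)
  also have "\<dots> = (\<Sum>i<k. \<Sum>j<k. if j = i then x i l * cnj (x j l) else 0)"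
    by (intro sum.cong refl) (simp add: onsD[OF assms])
  also have "\<dots> = (\<Sum>i<k. x i l * cnj (x i l))"
    by simp
  also have "\<dots> = of_real (weight k x l)" using gram_diag[of k x l] by (simp add: gram_def)
  finally show ?thesis using of_real_eq_iff by blast
qed

text \<open>A diagonal entry \<open>q\<close> of the projection satisfies
  \<open>q^2 \<le> q\<close>, because its square is one term of the squared row norm, which equals
  \<open>q\<close>.\<close>

lemma weight_le_1:
  assumes "ons n k x" "l < n"
  shows "weight k x l \<le> 1"
proof -
  have "(weight k x l)\<^sup>2 = (cmod (gram k x l l))\<^sup>2" by (simp add: gram_diag)
  also have "\<dots> \<le> (\<Sum>m<n. (cmod (gram k x l m))\<^sup>2)"
    using assms(2) by (intro member_le_sum) auto
  finally have "(weight k x l)\<^sup>2 \<le> weight k x l" by (simp add: gram_row_norm[OF assms(1)])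
  then have "weight k x l * (weight k x l - 1) \<le> 0" by (simp add: power2_eq_square algebra_simps)
  then show ?thesis using weight_nonneg[of k x l] by (auto simp: mult_le_0_iff)
qed

text \<open>The diagonal entry alone exhausts the squared row norm 1 and leaves nothing for the
  other entries.\<close>

lemma gram_offdiag_eq_0:
  assumes "ons n k x" "l < n" "m < n" "m \<noteq> l" "weight k x l = 1"
  shows "gram k x l m = 0"
proof -
  have "(\<Sum>m<n. (cmod (gram k x l m))\<^sup>2)
      = (cmod (gram k x l l))\<^sup>2 + (\<Sum>m\<in>{..<n}-{l}. (cmod (gram k x l m))\<^sup>2)"
    using assms(2) by (intro sum.remove) auto
  then have "(\<Sum>m\<in>{..<n}-{l}. (cmod (gram k x l m))\<^sup>2) = 0"
    by (simp add: gram_row_norm[OF assms(1)] gram_diag assms(5))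
  then have "(cmod (gram k x l m))\<^sup>2 = 0"
    using assms(3,4) by (subst (asm) sum_nonneg_eq_0_iff) auto
  then show ?thesis by simp
qed

text \<open>A square matrix with orthonormal columns has orthonormal rows: the \<open>n\<close>
  weights sum to \<open>n\<close> and none exceeds 1, so each equals 1.\<close>

lemma gram_basis:
  assumes "ons n n x" "l < n" "m < n"
  shows "gram n x l m = (if l = m then 1 else 0)"
proof -
  have "(\<Sum>l<n. 1 - weight n x l) = 0"
    by (simp add: sum_subtractf sum_weight[OF assms(1)])
  then have "\<forall>l\<in>{..<n}. 1 - weight n x l = 0"
    using weight_le_1[OF assms(1)] by (subst (asm) sum_nonneg_eq_0_iff) auto
  then have "weight n x l = 1" using assms(2) by simp
  then show ?thesis using gram_offdiag_eq_0[OF assms(1-3)] gram_diag[of n x l] by auto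
qed

section \<open>Coordinates in an orthonormal basis\<close>

lemma basis_expansion:
  assumes "ons n n v" "p < n"
  shows "(\<Sum>l<n. cip n f (v l) * v l p) = f p"
proof -
  have "(\<Sum>l<n. cip n f (v l) * v l p) = (\<Sum>l<n. \<Sum>q<n. f q * (v l p * cnj (v l q)))"
    by (simp add: cip_def sum_distrib_left mult_ac)
  also have "\<dots> = (\<Sum>q<n. \<Sum>l<n. f q * (v l p * cnj (v l q)))" by (rule sum.swap)
  also have "\<dots> = (\<Sum>q<n. f q * gram n v p q)" by (simp add: gram_def sum_distrib_left)
  also have "\<dots> = (\<Sum>q<n. if q = p then f q else 0)"
    by (intro sum.cong refl) (simp add: gram_basis[OF assms(1,2)])
  finally show ?thesis using assms(2) by simp
qed

lemma parseval:
  assumes "ons n n v"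
  shows "(\<Sum>l<n. cip n f (v l) * cnj (cip n g (v l))) = cip n f g"
proof -
  have "(\<Sum>l<n. cip n f (v l) * cnj (cip n g (v l))) = cip n (\<lambda>p. \<Sum>l<n. cip n f (v l) * v l p) g"
    by (simp add: cip_linear cip_commute[of n _ g])
  also have "\<dots> = cip n f g" by (rule cip_cong) (simp_all add: basis_expansion[OF assms])
  finally show ?thesis .
qed

text \<open>By Parseval, taking coordinates is an isometry. It allows Ky Fan's inequality to be
  proved for diagonal matrices only.\<close>

lemma ons_coordinates:
  assumes "ons n n v" "ons n k x"
  shows "ons n k (\<lambda>i l. cip n (x i) (v l))"
proof -
  have "cip n (\<lambda>l. cip n (x i) (v l)) (\<lambda>l. cip n (x j) (v l)) = cip n (x i) (x j)" for i j
    by (subst cip_def) (rule parseval[OF assms(1)])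
  then show ?thesis using assms(2) by (simp add: ons_def)
qed

section \<open>Phase changes and plane rotations of a family\<close>

lemma ons_phase:
  assumes "ons n k x" "cmod e = 1"
  shows "ons n k (x(i := \<lambda>l. e * x i l))"
proof -
  have "e * cnj e = 1" using assms(2) by (simp add: mult_cnj_self)
  then show ?thesis
    using assms(1) unfolding ons_def by (auto simp: cip_linear)
qed

text \<open>Both updates read the old \<open>x\<close>, so a 2 by 2 matrix acts on the members
  \<open>i\<close> and \<open>j\<close> simultaneously.\<close>

definition rot :: "nat \<Rightarrow> nat \<Rightarrow> complex \<Rightarrow> complex \<Rightarrow> complex \<Rightarrow> complex
    \<Rightarrow> (nat \<Rightarrow> nat \<Rightarrow> complex) \<Rightarrow> nat \<Rightarrow> nat \<Rightarrow> complex" where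
  "rot i j a b c d x = x(i := \<lambda>l. a * x i l + b * x j l, j := \<lambda>l. c * x i l + d * x j l)"

lemma ons_rot:
  assumes "ons n k x" "i < k" "j < k" "i \<noteq> j"
    and "a * cnj a + b * cnj b = 1" "c * cnj c + d * cnj d = 1" "a * cnj c + b * cnj d = 0"
  shows "ons n k (rot i j a b c d x)"
proof -
  have "c * cnj a + d * cnj b = 0"
    using arg_cong[OF assms(7), of cnj] by (simp add: mult.commute)
  then show ?thesis
    using assms unfolding ons_def rot_def
    by (auto simp: cip_linear algebra_simps)
qed

section \<open>Compactness and existence of singular value decompositions\<close>

text \<open>Tychonoff's theorem. Used twice, for the coordinates and for the members, it makes the
  box of families with entries in the unit disc compact.\<close>

lemma compact_Pi_UNIV:
  fixes S :: "'a \<Rightarrow> ('b::topological_space) set"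
  assumes "\<And>i. compact (S i)"
  shows "compact {f. \<forall>i. f i \<in> S i}"
proof -
  have "compactin (product_topology (\<lambda>_::'a. euclidean :: 'b topology) UNIV) (PiE UNIV S)"
    using assms by (simp add: compactin_PiE)
  moreover have "PiE UNIV S = {f. \<forall>i. f i \<in> S i}" by (auto simp: PiE_def Pi_def)
  ultimately show ?thesis by (simp add: euclidean_product_topology)
qed

lemma continuous_on_coordinates2:
  fixes f :: "'c::topological_space \<Rightarrow> 'a \<Rightarrow> 'b \<Rightarrow> 'd::topological_space"
  assumes "continuous_on X f"
  shows "continuous_on X (\<lambda>z. f z i j)"
  by (rule continuous_on_product_then_coordinatewise[OF continuous_on_product_then_coordinatewise[OF assms]])

lemma closed_ons:
  fixes f :: "'c::topological_space \<Rightarrow> nat \<Rightarrow> nat \<Rightarrow> complex"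
  assumes "continuous_on UNIV f"
  shows "closed {z. ons n k (f z)}"
proof -
  have coord: "continuous_on UNIV (\<lambda>z. f z i l)" for i l
    by (rule continuous_on_coordinates2[OF assms])
  show ?thesis unfolding ons_def cip_def
    by (intro closed_Collect_all closed_Collect_imp open_Collect_const closed_Collect_eq
        continuous_on_sum continuous_on_mult continuous_on_cnj coord continuous_on_const)
qed

lemma cmod_ons_le_1:
  assumes "ons n k x" "i < k" "l < n"
  shows "cmod (x i l) \<le> 1"
proof -
  have "(cmod (x i l))\<^sup>2 \<le> weight k x l"
    unfolding weight_def using assms(2) by (intro member_le_sum) auto
  also have "\<dots> \<le> 1" by (rule weight_le_1[OF assms(1,3)])
  finally show ?thesis by (simp add: abs_square_le_1)
qed

text \<open>Entries outside the \<open>k\<close> by \<open>n\<close> window are unconstrained, so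
  the feasible set itself is not compact. The truncation \<open>tr\<close> sets them to zero and
  lands in a compact box; by the hypothesis \<open>local\<close>, neither \<open>F\<close> nor
  \<open>P\<close> notices.\<close>

lemma max_over_ons_pairs:
  fixes F :: "(nat \<Rightarrow> nat \<Rightarrow> complex) \<Rightarrow> (nat \<Rightarrow> nat \<Rightarrow> complex) \<Rightarrow> real"
  assumes closed: "closed {z. P (fst z) (snd z)}"
    and cont: "continuous_on UNIV (\<lambda>z. F (fst z) (snd z))"
    and local: "\<And>x y x' y'. (\<And>i l. i < k \<Longrightarrow> l < n \<Longrightarrow> x i l = x' i l \<and> y i l = y' i l)
      \<Longrightarrow> F x y = F x' y' \<and> (P x y \<longleftrightarrow> P x' y')"
    and ex: "\<exists>x y. ons n k x \<and> ons n k y \<and> P x y"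
  obtains x y where "ons n k x" "ons n k y" "P x y"
    "\<And>x' y'. ons n k x' \<Longrightarrow> ons n k y' \<Longrightarrow> P x' y' \<Longrightarrow> F x' y' \<le> F x y"
proof -
  define B :: "(nat \<Rightarrow> nat \<Rightarrow> complex) set" where "B = {f. \<forall>i. f i \<in> {g. \<forall>l. g l \<in> cball 0 1}}"
  define K where "K = (B \<times> B) \<inter> {z. ons n k (fst z)} \<inter> {z. ons n k (snd z)} \<inter> {z. P (fst z) (snd z)}"
  define tr :: "(nat \<Rightarrow> nat \<Rightarrow> complex) \<Rightarrow> nat \<Rightarrow> nat \<Rightarrow> complex" where
    "tr x = (\<lambda>i l. if i < k \<and> l < n then x i l else 0)" for x
  have "compact B" unfolding B_def by (intro compact_Pi_UNIV compact_cball)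
  then have "compact K" unfolding K_def
    by (intro compact_Int_closed compact_Times closed_ons closed continuous_intros)
  have trK: "(tr x, tr y) \<in> K \<and> F (tr x) (tr y) = F x y"
    if "ons n k x" "ons n k y" "P x y" for x y
  proof -
    have "cip n (tr z i) (tr z j) = cip n (z i) (z j)" if "i < k" "j < k" for z i j
      using that by (intro cip_cong) (auto simp: tr_def)
    then have "ons n k (tr z) \<longleftrightarrow> ons n k z" for z
      by (simp add: ons_def)
    moreover have "tr z \<in> B" if "ons n k z" for z
      using cmod_ons_le_1[OF that] by (auto simp: B_def tr_def)
    moreover have "F (tr x) (tr y) = F x y \<and> (P (tr x) (tr y) \<longleftrightarrow> P x y)"
      by (rule local) (simp add: tr_def)
    ultimately show ?thesis using that by (simp add: K_def)
  qed
  then have "K \<noteq> {}" using ex by blast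
  then obtain z where z: "z \<in> K" "\<forall>w\<in>K. F (fst w) (snd w) \<le> F (fst z) (snd z)"
    using continuous_attains_sup[OF \<open>compact K\<close> _ continuous_on_subset[OF cont]] by blast
  show ?thesis
  proof (rule that)
    fix x' y' assume "ons n k x'" "ons n k y'" "P x' y'"
    from trK[OF this] z(2) show "F x' y' \<le> F (fst z) (snd z)" by force
  qed (use z in \<open>auto simp: K_def\<close>)
qed

lemma cip_unit:
  assumes "p < n"
  shows "cip n (\<lambda>l. if l = p then 1 else 0) g = cnj (g p)"
  unfolding cip_def using assms by (simp add: if_distrib[of "\<lambda>z. z * _"] cong: if_cong)

lemma ons_unit:
  assumes "inj_on p {..<k}" "p ` {..<k} \<subseteq> {..<n}"
  shows "ons n k (\<lambda>i l. if l = p i then 1 else 0)"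
  unfolding ons_def using assms by (auto simp: cip_unit image_subset_iff inj_on_def)

section \<open>Action of a matrix on vectors\<close>

definition mv :: "(nat \<Rightarrow> nat \<Rightarrow> complex) \<Rightarrow> nat \<Rightarrow> (nat \<Rightarrow> complex) \<Rightarrow> nat \<Rightarrow> complex" where
  "mv a n f l = (\<Sum>m<n. a l m * f m)"

lemma mv_cong: "(\<And>m. m < n \<Longrightarrow> f m = g m) \<Longrightarrow> mv a n f = mv a n g"
  by (auto simp: mv_def intro!: sum.cong)

lemma mv_add: "mv a n (\<lambda>l. f l + g l) = (\<lambda>l. mv a n f l + mv a n g l)"
  and mv_scale: "mv a n (\<lambda>l. c * f l) = (\<lambda>l. c * mv a n f l)"
  by (auto simp: mv_def sum.distrib sum_distrib_left algebra_simps)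

lemma mv_sum: "mv a n (\<lambda>l. \<Sum>i\<in>I. f i l) = (\<lambda>l. \<Sum>i\<in>I. mv a n (f i) l)"
  unfolding mv_def sum_distrib_left by (rule ext, rule sum.swap)

lemmas mv_linear = mv_add mv_scale mv_sum

text \<open>On the unit circle the linear form reaches \<open>sqrt (p^2 + q^2)\<close>, at the
  normalised point \<open>(p, q)\<close>, so a maximum at \<open>(1, 0)\<close> forces
  \<open>q = 0\<close>. This is the first-order condition for an extremum over rotations, without
  derivatives.\<close>

lemma rotation_max:
  fixes p q :: real
  assumes "\<And>C S. C\<^sup>2 + S\<^sup>2 = 1 \<Longrightarrow> C * p + S * q \<le> p"
  shows "q = 0"
proof (rule ccontr)
  assume "q \<noteq> 0"
  define r where "r = sqrt (p\<^sup>2 + q\<^sup>2)"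
  have "p\<^sup>2 + q\<^sup>2 > 0" using \<open>q \<noteq> 0\<close> by (simp add: sum_power2_gt_zero_iff)
  then have r: "r > 0" "r\<^sup>2 = p\<^sup>2 + q\<^sup>2" by (auto simp: r_def)
  have "(p/r)\<^sup>2 + (q/r)\<^sup>2 = 1"
    unfolding power_divide add_divide_distrib[symmetric] r(2)[symmetric] using r(1) by simp
  then have "p/r * p + q/r * q \<le> p" by (rule assms)
  moreover have "p/r * p + q/r * q = (p\<^sup>2 + q\<^sup>2) / r"
    by (simp add: power2_eq_square add_divide_distrib)
  moreover have "(p\<^sup>2 + q\<^sup>2) / r = r"
    unfolding r(2)[symmetric] using r(1) by (simp add: power2_eq_square)
  ultimately have "r \<le> p" by simp
  then have "r\<^sup>2 \<le> p\<^sup>2" using r by (intro power_mono) auto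
  then show False using r(2) \<open>q \<noteq> 0\<close> by simp
qed

lemma sum_remove2:
  assumes "finite A" "i \<in> A" "j \<in> A" "i \<noteq> j"
  shows "sum f A = f i + f j + sum f (A - {i} - {j})"
  using assms by (simp add: sum.remove[of A i] sum.remove[of "A - {i}" j] add.assoc)

text \<open>Serves to compare an extremal sum with a competitor that was altered at two indices
  only.\<close>

lemma two_terms_le:
  fixes f g :: "'a \<Rightarrow> real"
  assumes "finite A" "i \<in> A" "j \<in> A" "i \<noteq> j"
    and "\<And>l. l \<in> A \<Longrightarrow> l \<noteq> i \<Longrightarrow> l \<noteq> j \<Longrightarrow> f l = g l"
    and "sum f A \<le> sum g A"
  shows "f i + f j \<le> g i + g j"
proof -
  have "sum f (A - {i} - {j}) = sum g (A - {i} - {j})"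
    using assms(5) by (intro sum.cong) auto
  then show ?thesis using assms(6) sum_remove2[OF assms(1-4)] by (metis add_le_cancel_right)
qed

lemma Re_eq_cmod_imp: "cmod z \<le> Re z \<Longrightarrow> z = of_real (Re z) \<and> Re z \<ge> 0"
  using complex_Re_le_cmod[of z] cmod_power2[of z] norm_ge_zero[of z]
  by (auto simp: complex_eq_iff)

lemma continuous_on_pair_coordinates:
  fixes X :: "(('a \<Rightarrow> 'b \<Rightarrow> 'c::topological_space) \<times> ('a \<Rightarrow> 'b \<Rightarrow> 'c)) set"
  shows "continuous_on X (\<lambda>z. fst z i l)" "continuous_on X (\<lambda>z. snd z i l)"
  by (rule continuous_on_coordinates2, intro continuous_intros)+

lemma rot_simps:
  assumes "i \<noteq> j"
  shows "rot i j a b c d x i = (\<lambda>l. a * x i l + b * x j l)"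
    "rot i j a b c d x j = (\<lambda>l. c * x i l + d * x j l)"
    "p \<noteq> i \<Longrightarrow> p \<noteq> j \<Longrightarrow> rot i j a b c d x p = x p"
  using assms by (simp_all add: rot_def)

text \<open>The coefficient matrix is unitary for every phase \<open>e\<close>. The free phase gives
  access to both the real and the imaginary part of an entry.\<close>

lemma ons_rotation:
  fixes C S :: real
  assumes "ons n k x" "i < k" "j < k" "i \<noteq> j" "cmod e = 1" "C\<^sup>2 + S\<^sup>2 = 1"
  shows "ons n k (rot i j (of_real C) (e * of_real S) (- cnj e * of_real S) (of_real C) x)"
proof (rule ons_rot[OF assms(1-4)])
  have e: "e * cnj e = 1" "of_real C * of_real C + of_real S * of_real S = (1::complex)"
    using assms(5,6) by (simp_all add: mult_cnj_self power2_eq_square flip: of_real_mult of_real_add)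
  have 1: "of_real C * cnj (of_real C) + e * of_real S * cnj (e * of_real S)
      = of_real C * of_real C + (e * cnj e) * (of_real S * of_real S)"
    by simp
  show "of_real C * cnj (of_real C) + e * of_real S * cnj (e * of_real S) = 1"
    unfolding 1 e(1) using e(2) by simp
  have 2: "- cnj e * of_real S * cnj (- cnj e * of_real S) + of_real C * cnj (of_real C)
      = of_real C * of_real C + (e * cnj e) * (of_real S * of_real S)"
    by simp
  show "- cnj e * of_real S * cnj (- cnj e * of_real S) + of_real C * cnj (of_real C) = 1"
    unfolding 2 e(1) using e(2) by simp
qed simp

text \<open>At a maximum of \<open>\<Sum>i. c i * Re \<langle>A v\<^sub>i, u\<^sub>i\<rangle>\<close> over pairs of orthonormal bases, with strictly
  decreasing positive weights, the matrix \<open>N i j = \<langle>A v\<^sub>j, u\<^sub>i\<rangle>\<close> is diagonal: rotating \<open>v\<close>, respectively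
  \<open>u\<close>, in the \<open>(i, j)\<close>-plane yields \<open>c i * N i j = c j * cnj (N j i)\<close> and the same with \<open>i\<close> and
  \<open>j\<close> exchanged on the right.\<close>

lemma svd_exists:
  obtains u v s where "ons n n u" "ons n n v"
    "\<And>i l. i < n \<Longrightarrow> l < n \<Longrightarrow> mv a n (v i) l = of_real (s i) * u i l"
    "\<And>i. i < n \<Longrightarrow> s i \<ge> 0" "\<And>i j. i \<le> j \<Longrightarrow> j < n \<Longrightarrow> s j \<le> s i"
proof -
  define c where "c i = real (n - i)" for i
  define F where "F v u = (\<Sum>i<n. c i * Re (cip n (mv a n (v i)) (u i)))" for v u
  have cont: "continuous_on UNIV (\<lambda>z. F (fst z) (snd z))"
    unfolding F_def cip_def mv_def
    by (intro continuous_on_sum continuous_on_mult continuous_on_const continuous_on_Re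
        continuous_on_cnj continuous_on_pair_coordinates)
  obtain v u where v: "ons n n v" and u: "ons n n u"
    and max: "\<And>v' u'. ons n n v' \<Longrightarrow> ons n n u' \<Longrightarrow> F v' u' \<le> F v u"
  proof (rule max_over_ons_pairs[where F = F and P = "\<lambda>_ _. True" and n = n and k = n])
    show "F x y = F x' y' \<and> True = True"
      if eq: "\<And>i l. i < n \<Longrightarrow> l < n \<Longrightarrow> x i l = x' i l \<and> y i l = y' i l" for x y x' y'
    proof -
      have "mv a n (x i) = mv a n (x' i)" if "i < n" for i
        using that eq by (intro mv_cong) simp
      then have "cip n (mv a n (x i)) (y i) = cip n (mv a n (x' i)) (y' i)" if "i < n" for i
        using that eq by (intro cip_cong) auto
      then show ?thesis by (simp add: F_def)
    qed
    show "\<exists>x y. ons n n x \<and> ons n n y \<and> True"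
      using ons_unit[of id n n] by auto
  qed (use cont in auto)
  define N where "N i j = cip n (mv a n (v j)) (u i)" for i j
  have diag: "N i i = of_real (Re (N i i)) \<and> Re (N i i) \<ge> 0" if "i < n" for i
  proof (cases "N i i = 0")
    case False
    \<comment> \<open>Multiplying \<open>v i\<close> by this phase replaces \<open>N i i\<close> by
      its modulus; maximality then gives \<open>cmod (N i i) \<le> Re (N i i)\<close>.\<close>
    define e where "e = cnj (sgn (N i i))"
    have e: "cmod e = 1" "e * N i i = cmod (N i i)"
      using False mult_cnj_self[of "N i i"]
      by (auto simp: e_def norm_divide sgn_eq field_simps power2_eq_square)
    let ?v = "v(i := \<lambda>l. e * v i l)"
    have "F ?v u \<le> F v u" using max ons_phase[OF v e(1)] u by blast
    moreover have "F w u = c i * Re (cip n (mv a n (w i)) (u i))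
        + (\<Sum>l\<in>{..<n}-{i}. c l * Re (cip n (mv a n (w l)) (u l)))" for w
      unfolding F_def using that by (intro sum.remove) auto
    moreover have "(\<Sum>l\<in>{..<n}-{i}. c l * Re (cip n (mv a n (?v l)) (u l)))
        = (\<Sum>l\<in>{..<n}-{i}. c l * Re (cip n (mv a n (v l)) (u l)))"
      by (intro sum.cong) auto
    ultimately have "c i * Re (e * N i i) \<le> c i * Re (N i i)"
      by (simp add: N_def mv_linear cip_linear)
    then have "cmod (N i i) \<le> Re (N i i)" using that e(2) by (simp add: c_def)
    then show ?thesis by (rule Re_eq_cmod_imp)
  qed simp
  have two: "c i * Re (cip n (mv a n (v' i)) (u' i)) + c j * Re (cip n (mv a n (v' j)) (u' j))
      \<le> c i * Re (N i i) + c j * Re (N j j)"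
    if "i < n" "j < n" "i \<noteq> j" "ons n n v'" "ons n n u'"
      "\<And>l. l \<noteq> i \<Longrightarrow> l \<noteq> j \<Longrightarrow> v' l = v l \<and> u' l = u l" for i j v' u'
    unfolding N_def using that(1-3) max[OF that(4,5)] that(6)
    by (intro two_terms_le[where A = "{..<n}"
        and f = "\<lambda>i. c i * Re (cip n (mv a n (v' i)) (u' i))"
        and g = "\<lambda>i. c i * Re (cip n (mv a n (v i)) (u i))"])
      (auto simp: F_def)
  have v_rot_entries: "cip n (mv a n (rot i j \<alpha> \<beta> \<gamma> \<delta> v i)) (u i) = \<alpha> * N i i + \<beta> * N i j"
    "cip n (mv a n (rot i j \<alpha> \<beta> \<gamma> \<delta> v j)) (u j) = \<gamma> * N j i + \<delta> * N j j"
    if "i \<noteq> j" for i j \<alpha> \<beta> \<gamma> \<delta>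
    by (simp_all add: rot_simps[OF that] mv_linear cip_linear N_def)
  have u_rot_entries:
    "cip n (mv a n (v i)) (rot i j \<alpha> \<beta> \<gamma> \<delta> u i) = cnj \<alpha> * N i i + cnj \<beta> * N j i"
    "cip n (mv a n (v j)) (rot i j \<alpha> \<beta> \<gamma> \<delta> u j) = cnj \<gamma> * N i j + cnj \<delta> * N j j"
    if "i \<noteq> j" for i j \<alpha> \<beta> \<gamma> \<delta>
    by (simp_all add: rot_simps[OF that] mv_linear cip_linear N_def)
  have v_rot: "c i * Re (e * N i j) = c j * Re (cnj e * N j i)"
    if "i < n" "j < n" "i \<noteq> j" "cmod e = 1" for i j e
  proof -
    have "C * (c i * Re (N i i) + c j * Re (N j j))
        + S * (c i * Re (e * N i j) - c j * Re (cnj e * N j i))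
        \<le> c i * Re (N i i) + c j * Re (N j j)" if "C\<^sup>2 + S\<^sup>2 = 1" for C S
      using two[OF \<open>i < n\<close> \<open>j < n\<close> \<open>i \<noteq> j\<close> ons_rotation[OF v \<open>i < n\<close> \<open>j < n\<close> \<open>i \<noteq> j\<close> \<open>cmod e = 1\<close> that] u]
        \<open>i \<noteq> j\<close>
      by (simp add: v_rot_entries[OF \<open>i \<noteq> j\<close>] rot_simps(3) algebra_simps)
    from rotation_max[OF this] show ?thesis by simp
  qed
  have u_rot: "c i * Re (cnj e * N j i) = c j * Re (e * N i j)"
    if "i < n" "j < n" "i \<noteq> j" "cmod e = 1" for i j e
  proof -
    have "C * (c i * Re (N i i) + c j * Re (N j j))
        + S * (c i * Re (cnj e * N j i) - c j * Re (e * N i j))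
        \<le> c i * Re (N i i) + c j * Re (N j j)" if "C\<^sup>2 + S\<^sup>2 = 1" for C S
      using two[OF \<open>i < n\<close> \<open>j < n\<close> \<open>i \<noteq> j\<close> v ons_rotation[OF u \<open>i < n\<close> \<open>j < n\<close> \<open>i \<noteq> j\<close> \<open>cmod e = 1\<close> that]]
        \<open>i \<noteq> j\<close>
      by (simp add: u_rot_entries[OF \<open>i \<noteq> j\<close>] rot_simps(3) algebra_simps)
    from rotation_max[OF this] show ?thesis by simp
  qed
  have offdiag: "N i j = 0" if "i < n" "j < n" "i \<noteq> j" for i j
  proof -
    have "Re (e * N i j) = 0" if e: "cmod e = 1" for e
    proof -
      have "c i * (c i * Re (e * N i j)) = c j * (c j * Re (e * N i j))"
        using v_rot[OF \<open>i < n\<close> \<open>j < n\<close> \<open>i \<noteq> j\<close> e] u_rot[OF \<open>i < n\<close> \<open>j < n\<close> \<open>i \<noteq> j\<close> e]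
        by (simp add: mult.left_commute)
      \<comment> \<open>Eliminating \<open>N j i\<close> leaves the factor
        \<open>(c i)^2 - (c j)^2\<close>, which is nonzero since the weights are positive and
        distinct.\<close>
      then have "((c i - c j) * (c i + c j)) * Re (e * N i j) = 0" by (simp add: algebra_simps)
      moreover have "c i \<noteq> c j" "c i + c j > 0" using \<open>i < n\<close> \<open>j < n\<close> \<open>i \<noteq> j\<close> by (auto simp: c_def)
      ultimately show ?thesis by simp
    qed
    \<comment> \<open>The phases \<open>1\<close> and \<open>\<i>\<close> test the real and the
      imaginary part.\<close>
    from this[of 1] this[of \<i>] show ?thesis by (simp add: complex_eq_iff)
  qed
  have antitone: "Re (N j j) \<le> Re (N i i)" if "i < j" "j < n" for i j
  proof -
    have ij: "i < n" "j < n" "i \<noteq> j" using that by auto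
    \<comment> \<open>These coefficients swap the members \<open>i\<close> and \<open>j\<close>.
      Swapping in both bases exchanges two diagonal entries, and the larger weight at
      \<open>i\<close> then fixes their order.\<close>
    have "ons n n (rot i j 0 1 1 0 w)" if "ons n n w" for w
      by (rule ons_rot[OF that ij]) auto
    then have "c i * Re (N j j) + c j * Re (N i i) \<le> c i * Re (N i i) + c j * Re (N j j)"
      using two[OF ij, of "rot i j 0 1 1 0 v" "rot i j 0 1 1 0 u"] v u ij(3)
      by (simp add: rot_def N_def[symmetric])
    then have "(c i - c j) * (Re (N j j) - Re (N i i)) \<le> 0" by (simp add: algebra_simps)
    moreover have "c i - c j > 0" using that by (auto simp: c_def)
    ultimately show ?thesis by (simp add: mult_le_0_iff)
  qed
  show ?thesis
  proof (rule that[OF u v])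
    fix i l assume "i < n" "l < n"
    have "mv a n (v i) l = (\<Sum>p<n. N p i * u p l)"
      unfolding N_def using basis_expansion[OF u \<open>l < n\<close>] by simp
    also have "\<dots> = (\<Sum>p<n. if p = i then N i i * u i l else 0)"
      using \<open>i < n\<close> offdiag by (intro sum.cong) auto
    also have "\<dots> = of_real (Re (N i i)) * u i l" using \<open>i < n\<close> diag[of i] by simp
    finally show "mv a n (v i) l = of_real (Re (N i i)) * u i l" .
  next
    fix i j assume "i \<le> j" "j < n"
    then show "Re (N j j) \<le> Re (N i i)" using antitone by (cases "i = j") auto
  qed (use diag in auto)
qed

section \<open>Ky Fan's inequality and its equality case\<close>

text \<open>The factorization in the form \<open>A V = U S\<close>, column by column; sign and order
  of \<open>s\<close> are left to \<open>nonneg_decr\<close>.\<close>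

definition svd :: "nat \<Rightarrow> (nat \<Rightarrow> nat \<Rightarrow> complex) \<Rightarrow> (nat \<Rightarrow> nat \<Rightarrow> complex) \<Rightarrow> (nat \<Rightarrow> real)
    \<Rightarrow> (nat \<Rightarrow> nat \<Rightarrow> complex) \<Rightarrow> bool" where
  "svd n a u s v \<longleftrightarrow> ons n n u \<and> ons n n v \<and>
     (\<forall>i<n. \<forall>l<n. mv a n (v i) l = of_real (s i) * u i l)"

definition nonneg_decr :: "nat \<Rightarrow> (nat \<Rightarrow> real) \<Rightarrow> bool" where
  "nonneg_decr n s \<longleftrightarrow> (\<forall>i<n. 0 \<le> s i) \<and> (\<forall>i j. i \<le> j \<longrightarrow> j < n \<longrightarrow> s j \<le> s i)"

lemma svd_apply:
  assumes "svd n a u s v" "p < n"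
  shows "mv a n f p = (\<Sum>l<n. cip n f (v l) * of_real (s l) * u l p)"
proof -
  have v: "ons n n v" using assms(1) by (simp add: svd_def)
  have "mv a n f = mv a n (\<lambda>q. \<Sum>l<n. cip n f (v l) * v l q)"
    by (rule mv_cong) (simp add: basis_expansion[OF v])
  then have "mv a n f p = mv a n (\<lambda>q. \<Sum>l<n. cip n f (v l) * v l q) p" by simp
  also have "\<dots> = (\<Sum>l<n. cip n f (v l) * mv a n (v l) p)"
    by (simp add: mv_linear)
  also have "\<dots> = (\<Sum>l<n. cip n f (v l) * of_real (s l) * u l p)"
    using assms by (intro sum.cong) (auto simp: svd_def)
  finally show ?thesis .
qed

text \<open>Reduces questions about \<open>a\<close> to the diagonal matrix of the
  \<open>s l\<close>, acting between coordinates along \<open>v\<close> and along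
  \<open>u\<close>.\<close>

lemma svd_form:
  assumes "svd n a u s v"
  shows "cip n (mv a n f) g = (\<Sum>l<n. of_real (s l) * (cip n f (v l) * cnj (cip n g (u l))))"
proof -
  have "cip n (mv a n f) g = cip n (\<lambda>p. \<Sum>l<n. cip n f (v l) * of_real (s l) * u l p) g"
    by (rule cip_cong) (simp_all add: svd_apply[OF assms])
  also have "\<dots> = (\<Sum>l<n. cip n f (v l) * of_real (s l) * cip n (u l) g)"
    unfolding cip_linear ..
  also have "\<dots> = (\<Sum>l<n. of_real (s l) * (cip n f (v l) * cnj (cip n g (u l))))"
    by (intro sum.cong refl) (simp add: cip_commute[of n g])
  finally show ?thesis .
qed

text \<open>Solved for the cross term, this bounds it by the mean of the two weights, with an
  explicit nonnegative remainder.\<close>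

lemma weight_diff:
  assumes "cmod e = 1"
  shows "weight k (\<lambda>i l. x i l - e * y i l) l
    = weight k x l + weight k y l - 2 * Re (cnj e * (\<Sum>i<k. x i l * cnj (y i l)))"
proof -
  have "(cmod (p - e * q))\<^sup>2 = (cmod p)\<^sup>2 + (cmod q)\<^sup>2 - 2 * Re (cnj e * (p * cnj q))" for p q
  proof -
    have "(cmod (p - r))\<^sup>2 = (cmod p)\<^sup>2 + (cmod r)\<^sup>2 - 2 * Re (p * cnj r)" for r
      unfolding cmod_power2 by (simp add: power2_eq_square algebra_simps)
    from this[of "e * q"] show ?thesis using assms
      by (simp add: norm_mult mult_ac del: minus_complex.simps times_complex.simps)
  qed
  then show ?thesis
    by (simp add: weight_def sum.distrib sum_subtractf sum_distrib_left
        del: times_complex.simps)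
qed

text \<open>The defect in Ky Fan's inequality, for an arbitrary threshold \<open>t\<close>. If \<open>t\<close> separates
  \<open>s 0, \<dots>, s (k - 1)\<close> from the remaining \<open>s l\<close>, then each of the three sums is nonnegative.\<close>

lemma ky_fan_defect:
  fixes s :: "nat \<Rightarrow> real" and t :: real
  assumes x: "ons n k x" and y: "ons n k y" and "k \<le> n"
  defines "w \<equiv> \<lambda>l. (weight k x l + weight k y l) / 2"
  obtains e where "cmod e = 1"
    "(\<Sum>l<k. s l) - cmod (\<Sum>l<n. of_real (s l) * (\<Sum>i<k. x i l * cnj (y i l)))
     = (\<Sum>l<k. (s l - t) * (1 - w l)) + (\<Sum>l=k..<n. (t - s l) * w l)
       + (\<Sum>l<n. s l * weight k (\<lambda>i l. x i l - e * y i l) l) / 2"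
proof -
  define c where "c l = (\<Sum>i<k. x i l * cnj (y i l))" for l
  define z where "z = (\<Sum>l<n. of_real (s l) * c l)"
  \<comment> \<open>The phase of \<open>z\<close>; the value 1 at \<open>z = 0\<close> keeps it
    unimodular in every case.\<close>
  define e where "e = (if z = 0 then 1 else sgn z)"
  have e: "cmod e = 1" by (simp add: e_def norm_sgn)
  have ez: "cnj e * z = of_real (cmod z)"
  proof (cases "z = 0")
    case False
    have "cnj z * z = of_real (cmod z) * of_real (cmod z)"
      using mult_cnj_self[of z] by (simp add: power2_eq_square mult.commute)
    then show ?thesis using False by (simp add: e_def sgn_eq field_simps)
  qed simp
  have "cmod z = Re (cnj e * z)" by (simp only: ez Re_complex_of_real)
  also have "\<dots> = (\<Sum>l<n. s l * Re (cnj e * c l))"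
    unfolding z_def sum_distrib_left Re_sum
    by (intro sum.cong refl) (simp add: algebra_simps)
  also have "\<dots> = (\<Sum>l<n. s l * w l - s l * weight k (\<lambda>i l. x i l - e * y i l) l / 2)"
    unfolding weight_diff[OF e] w_def c_def
    by (intro sum.cong refl) (simp only: diff_divide_distrib add_divide_distrib, argo)
  finally have z: "cmod z
      = (\<Sum>l<n. s l * w l) - (\<Sum>l<n. s l * weight k (\<lambda>i l. x i l - e * y i l) l) / 2"
    by (simp add: sum_subtractf sum_divide_distrib)
  have split: "sum g {..<n} = sum g {..<k} + sum g {k..<n}" for g :: "nat \<Rightarrow> real"
    using sum.atLeastLessThan_concat[of 0 k n g] \<open>k \<le> n\<close> by (simp add: lessThan_atLeast0)
  \<comment> \<open>Since \<open>w\<close> has total mass \<open>k\<close>, the threshold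
    \<open>t\<close> can be subtracted from every \<open>s l\<close> without changing the
    defect.\<close>
  have "(\<Sum>l<n. w l) = real k"
    unfolding w_def by (simp add: sum.distrib sum_weight[OF x] sum_weight[OF y] flip: sum_divide_distrib)
  then have "t * real k = t * (\<Sum>l<k. w l) + t * (\<Sum>l=k..<n. w l)"
    using split[of w] by (simp flip: distrib_left)
  then have "(\<Sum>l<k. s l) - (\<Sum>l<n. s l * w l)
      = (\<Sum>l<k. (s l - t) * (1 - w l)) + (\<Sum>l=k..<n. (t - s l) * w l)"
    by (simp add: split[of "\<lambda>l. s l * w l"] algebra_simps sum.distrib sum_subtractf
        flip: sum_distrib_left)
  then show ?thesis using that[OF e] z unfolding z_def c_def by simp
qed

text \<open>With a separating threshold all three parts of the defect are nonnegative, because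
  \<open>w\<close> is a mean of projection weights and lies between 0 and 1.\<close>

lemma ky_fan:
  assumes x: "ons n k x" and y: "ons n k y" and kn: "k \<le> n" and s: "nonneg_decr n s"
  shows "cmod (\<Sum>l<n. of_real (s l) * (\<Sum>i<k. x i l * cnj (y i l))) \<le> (\<Sum>l<k. s l)"
proof -
  \<comment> \<open>For \<open>k = n\<close> the tail sum is empty, and 0 is a valid threshold since
    the \<open>s l\<close> are nonnegative.\<close>
  define t where "t = (if k < n then s k else 0)"
  define w where "w = (\<lambda>l. (weight k x l + weight k y l) / 2)"
  obtain e where defect:
    "(\<Sum>l<k. s l) - cmod (\<Sum>l<n. of_real (s l) * (\<Sum>i<k. x i l * cnj (y i l)))
     = (\<Sum>l<k. (s l - t) * (1 - w l)) + (\<Sum>l=k..<n. (t - s l) * w l)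
       + (\<Sum>l<n. s l * weight k (\<lambda>i l. x i l - e * y i l) l) / 2"
    using ky_fan_defect[OF x y kn, of s t] unfolding w_def by blast
  have w: "0 \<le> w l" "l < n \<Longrightarrow> w l \<le> 1" for l
    using weight_nonneg[of k x l] weight_nonneg[of k y l] weight_le_1[OF x, of l] weight_le_1[OF y, of l]
    by (auto simp: w_def)
  have "(\<Sum>l<k. (s l - t) * (1 - w l)) \<ge> 0"
    using s kn w by (intro sum_nonneg mult_nonneg_nonneg) (auto simp: t_def nonneg_decr_def)
  moreover have "(\<Sum>l=k..<n. (t - s l) * w l) \<ge> 0"
    using s kn w by (intro sum_nonneg mult_nonneg_nonneg) (auto simp: t_def nonneg_decr_def)
  moreover have "(\<Sum>l<n. s l * weight k (\<lambda>i l. x i l - e * y i l) l) \<ge> 0"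
    using s by (intro sum_nonneg mult_nonneg_nonneg weight_nonneg) (auto simp: nonneg_decr_def)
  ultimately show ?thesis using defect by linarith
qed

text \<open>Equality makes the nonnegative parts of the defect vanish. The tail sum kills the
  coordinates from \<open>k\<close> on, and the last sum forces \<open>x = e y\<close> in every
  coordinate with \<open>s l > 0\<close>.\<close>

lemma ky_fan_equality:
  assumes x: "ons n k x" and y: "ons n k y" and kn: "0 < k" "k \<le> n" and s: "nonneg_decr n s"
    and jump: "k < n \<Longrightarrow> s k < s (k - 1)"
    and eq: "cmod (\<Sum>l<n. of_real (s l) * (\<Sum>i<k. x i l * cnj (y i l))) = (\<Sum>l<k. s l)"
  obtains e where "cmod e = 1"
    "\<And>i l. i < k \<Longrightarrow> l < n \<Longrightarrow> s l > 0 \<Longrightarrow> x i l = e * y i l"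
    "\<And>i l. i < k \<Longrightarrow> k \<le> l \<Longrightarrow> l < n \<Longrightarrow> x i l = 0 \<and> y i l = 0"
proof -
  \<comment> \<open>For \<open>k < n\<close> the midpoint lies strictly above \<open>s k\<close>, so
    every factor \<open>t - s l\<close> of the tail is positive and the tail weights must
    vanish.\<close>
  define t where "t = (if k < n then (s k + s (k - 1)) / 2 else 0)"
  define w where "w = (\<lambda>l. (weight k x l + weight k y l) / 2)"
  obtain e where e: "cmod e = 1" and defect:
    "(\<Sum>l<k. s l) - cmod (\<Sum>l<n. of_real (s l) * (\<Sum>i<k. x i l * cnj (y i l)))
     = (\<Sum>l<k. (s l - t) * (1 - w l)) + (\<Sum>l=k..<n. (t - s l) * w l)
       + (\<Sum>l<n. s l * weight k (\<lambda>i l. x i l - e * y i l) l) / 2"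
    using ky_fan_defect[OF x y kn(2), of s t] unfolding w_def by blast
  have w: "0 \<le> w l" "l < n \<Longrightarrow> w l \<le> 1" for l
    using weight_nonneg[of k x l] weight_nonneg[of k y l] weight_le_1[OF x, of l] weight_le_1[OF y, of l]
    by (auto simp: w_def)
  have s_ge: "s l \<ge> t" if "l < k" for l
  proof -
    have "s l \<ge> s (k - 1)" "s l \<ge> 0" using s kn that by (auto simp: nonneg_decr_def)
    then show ?thesis using jump by (auto simp: t_def)
  qed
  have s_lt: "s l < t" if "k \<le> l" "l < n" for l
  proof -
    have "s l \<le> s k" using s that by (auto simp: nonneg_decr_def)
    then show ?thesis using jump that by (auto simp: t_def)
  qed
  have n1: "(\<Sum>l<k. (s l - t) * (1 - w l)) \<ge> 0"
    using s_ge kn w by (intro sum_nonneg mult_nonneg_nonneg) auto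
  have n2: "(t - s l) * w l \<ge> 0" if "l \<in> {k..<n}" for l
    using s_lt[of l] w[of l] that by (intro mult_nonneg_nonneg) auto
  have n3: "s l * weight k (\<lambda>i l. x i l - e * y i l) l \<ge> 0" if "l \<in> {..<n}" for l
    using s that by (intro mult_nonneg_nonneg weight_nonneg) (auto simp: nonneg_decr_def)
  have n2': "(\<Sum>l=k..<n. (t - s l) * w l) \<ge> 0"
    by (intro sum_nonneg n2)
  have n3': "(\<Sum>l<n. s l * weight k (\<lambda>i l. x i l - e * y i l) l) \<ge> 0"
    by (intro sum_nonneg n3)
  have z2': "(\<Sum>l=k..<n. (t - s l) * w l) = 0"
    and z3': "(\<Sum>l<n. s l * weight k (\<lambda>i l. x i l - e * y i l) l) = 0"
    using defect eq n1 n2' n3' by linarith+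
  have z2: "\<forall>l\<in>{k..<n}. (t - s l) * w l = 0"
    using z2' n2 by (subst (asm) sum_nonneg_eq_0_iff) auto
  have z3: "\<forall>l\<in>{..<n}. s l * weight k (\<lambda>i l. x i l - e * y i l) l = 0"
    using z3' n3 by (subst (asm) sum_nonneg_eq_0_iff) auto
  have weight_0: "z i l = 0" if "weight k z l = 0" "i < k" for z i l
    using that unfolding weight_def by (subst (asm) sum_nonneg_eq_0_iff) auto
  show ?thesis
  proof (rule that[OF e])
    fix i l assume "i < k" "l < n" "s l > 0"
    then have "weight k (\<lambda>i l. x i l - e * y i l) l = 0" using bspec[OF z3, of l] by simp
    from weight_0[OF this \<open>i < k\<close>] show "x i l = e * y i l" by simp
  next
    fix i l assume il: "i < k" "k \<le> l" "l < n"
    then have "w l = 0" using z2 s_lt[of l] by auto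
    then have "weight k x l = 0" "weight k y l = 0"
      using weight_nonneg[of k x l] weight_nonneg[of k y l] by (auto simp: w_def)
    then show "x i l = 0 \<and> y i l = 0" using weight_0 \<open>i < k\<close> by blast
  qed
qed

section \<open>Equality in Ky Fan's inequality under the trace constraint\<close>

definition traceless :: "nat \<Rightarrow> nat \<Rightarrow> (nat \<Rightarrow> nat \<Rightarrow> complex) \<Rightarrow> (nat \<Rightarrow> nat \<Rightarrow> complex) \<Rightarrow> bool" where
  "traceless n k x y \<longleftrightarrow> (\<Sum>j<k. cip n (x j) (y j)) = 0"

lemma svd_form_sum:
  assumes "svd n a u s v"
  shows "(\<Sum>i<k. cip n (mv a n (x i)) (y i))
    = (\<Sum>l<n. of_real (s l) * (\<Sum>i<k. cip n (x i) (v l) * cnj (cip n (y i) (u l))))"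
  unfolding svd_form[OF assms] sum_distrib_left by (rule sum.swap)

lemma ky_fan_svd:
  assumes "svd n a u s v" "nonneg_decr n s" "k \<le> n" "ons n k x" "ons n k y"
  shows "cmod (\<Sum>i<k. cip n (mv a n (x i)) (y i)) \<le> (\<Sum>l<k. s l)"
  unfolding svd_form_sum[OF assms(1)]
  using assms by (intro ky_fan ons_coordinates) (auto simp: svd_def)

text \<open>At a strict drop of the singular values, equality in Ky Fan's inequality forces the families
  to be, up to a common phase, matching orthonormal bases of the leading singular subspaces.\<close>

lemma traceless_leading_block:
  assumes svd: "svd n a u s v" and s: "nonneg_decr n s" and k: "0 < k" "k < n" "s k < s (k - 1)"
    and x: "ons n k x" and y: "ons n k y" and tr: "traceless n k x y"
    and eq: "cmod (\<Sum>i<k. cip n (mv a n (x i)) (y i)) = (\<Sum>l<k. s l)"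
  shows "traceless n k v u"
proof -
  have u: "ons n n u" and v: "ons n n v" using svd by (auto simp: svd_def)
  define X where "X = (\<lambda>i l. cip n (x i) (v l))"
  define Y where "Y = (\<lambda>i l. cip n (y i) (u l))"
  have X: "ons n k X" and Y: "ons n k Y"
    unfolding X_def Y_def using ons_coordinates u v x y by blast+
  obtain e where e: "cmod e = 1"
    and 1: "\<And>i l. i < k \<Longrightarrow> l < n \<Longrightarrow> s l > 0 \<Longrightarrow> X i l = e * Y i l"
    and 0: "\<And>i l. i < k \<Longrightarrow> k \<le> l \<Longrightarrow> l < n \<Longrightarrow> X i l = 0 \<and> Y i l = 0"
    using ky_fan_equality[OF X Y k(1) less_imp_le[OF k(2)] s k(3)]
      eq[unfolded svd_form_sum[OF svd]] unfolding X_def Y_def by blast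
  \<comment> \<open>For \<open>l < k\<close> the drop gives
    \<open>s l \<ge> s (k - 1) > s k \<ge> 0\<close>, so the phase relation applies; from
    \<open>k\<close> on both coordinates vanish.\<close>
  have XY: "X i l = e * Y i l" if "i < k" "l < n" for i l
  proof (cases "l < k")
    case True
    then have "s (k - 1) \<le> s l" "0 \<le> s k" using s k by (auto simp: nonneg_decr_def)
    then show ?thesis using 1[OF that] k(3) by auto
  qed (use 0 that in auto)
  have Y0: "weight k Y l = 0" if "l \<in> {k..<n}" for l
    using 0 that by (simp add: weight_def)
  \<comment> \<open>The weights of \<open>Y\<close> are concentrated on the first \<open>k\<close>
    coordinates, sum to \<open>k\<close> and are at most 1, hence equal 1 there.\<close>
  have "(\<Sum>l<k. weight k Y l) = (\<Sum>l<n. weight k Y l)"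
    using k Y0 by (intro sum.mono_neutral_left) auto
  then have "(\<Sum>l<k. 1 - weight k Y l) = 0"
    by (simp add: sum_weight[OF Y] sum_subtractf)
  moreover have "1 - weight k Y l \<ge> 0" if "l \<in> {..<k}" for l
    using weight_le_1[OF Y, of l] that k by auto
  ultimately have "\<forall>l\<in>{..<k}. 1 - weight k Y l = 0"
    by (subst (asm) sum_nonneg_eq_0_iff) auto
  then have Y1: "weight k Y l = 1" if "l < k" for l
    using that by auto
  \<comment> \<open>The projection onto the span of \<open>Y\<close> is the projection onto the
    first \<open>k\<close> coordinates.\<close>
  have gram_Y: "gram k Y l m = (if m = l \<and> l < k then 1 else 0)" if "l < n" "m < n" for l m
  proof (cases "l < k")
    case True
    then show ?thesis
      using gram_offdiag_eq_0[OF Y that _ Y1] gram_diag[of k Y l] Y1 by (cases "m = l") auto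
  next
    case False
    then show ?thesis using 0 that by (auto simp: gram_def)
  qed
  \<comment> \<open>Expanding \<open>x j\<close> in \<open>v\<close> and \<open>y j\<close> in
    \<open>u\<close> turns the constraint into the unimodular factor \<open>e\<close> times the
    leading trace.\<close>
  have "(\<Sum>j<k. cip n (x j) (y j))
      = (\<Sum>j<k. cip n (\<lambda>p. \<Sum>l<n. X j l * v l p) (\<lambda>p. \<Sum>m<n. Y j m * u m p))"
    unfolding X_def Y_def
    by (intro sum.cong refl cip_cong) (simp_all add: basis_expansion u v)
  also have "\<dots> = (\<Sum>j<k. \<Sum>m<n. \<Sum>l<n. X j m * (cnj (Y j l) * cip n (v m) (u l)))"
    by (simp add: cip_linear sum_distrib_left mult_ac)
  also have "\<dots> = (\<Sum>j<k. \<Sum>m<n. \<Sum>l<n. e * (Y j m * cnj (Y j l)) * cip n (v m) (u l))"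
    by (intro sum.cong refl) (simp add: XY)
  also have "\<dots> = (\<Sum>m<n. \<Sum>j<k. \<Sum>l<n. e * (Y j m * cnj (Y j l)) * cip n (v m) (u l))"
    by (rule sum.swap)
  also have "\<dots> = (\<Sum>m<n. \<Sum>l<n. \<Sum>j<k. e * (Y j m * cnj (Y j l)) * cip n (v m) (u l))"
    by (rule sum.cong[OF refl], rule sum.swap)
  also have "\<dots> = (\<Sum>m<n. \<Sum>l<n. e * gram k Y m l * cip n (v m) (u l))"
    by (simp add: gram_def sum_distrib_left sum_distrib_right)
  also have "\<dots> = (\<Sum>m<n. \<Sum>l<n. if l = m then (if m < k then e * cip n (v m) (u m) else 0) else 0)"
    by (intro sum.cong refl) (auto simp: gram_Y)
  also have "\<dots> = (\<Sum>m<n. if m < k then e * cip n (v m) (u m) else 0)"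
    by (intro sum.cong refl) simp
  also have "\<dots> = (\<Sum>m<k. e * cip n (v m) (u m))"
    using k(2) by (intro sum.mono_neutral_cong_right) auto
  also have "\<dots> = e * (\<Sum>m<k. cip n (v m) (u m))"
    by (simp add: sum_distrib_left)
  finally show ?thesis using tr e unfolding traceless_def by auto
qed

text \<open>For \<open>k = n\<close> equality links \<open>x\<close> and \<open>y\<close> only along
  positive singular values. On the kernel the right singular vectors may be any orthonormal basis,
  so \<open>v\<close> can be replaced there by vectors built from \<open>x\<close>, which carry over
  the trace condition.\<close>

lemma exists_traceless_svd:
  assumes svd: "svd n a u s v" and s: "nonneg_decr n s" and n: "0 < n"
    and x: "ons n n x" and y: "ons n n y" and tr: "traceless n n x y"
    and eq: "cmod (\<Sum>i<n. cip n (mv a n (x i)) (y i)) = (\<Sum>l<n. s l)"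
  shows "\<exists>v'. svd n a u s v' \<and> traceless n n v' u"
proof -
  have u: "ons n n u" and v: "ons n n v" using svd by (auto simp: svd_def)
  define X where "X = (\<lambda>i l. cip n (x i) (v l))"
  define Y where "Y = (\<lambda>i l. cip n (y i) (u l))"
  have X: "ons n n X" and Y: "ons n n Y"
    unfolding X_def Y_def using ons_coordinates u v x y by blast+
  obtain e where e: "cmod e = 1"
    and XY: "\<And>i l. i < n \<Longrightarrow> l < n \<Longrightarrow> s l > 0 \<Longrightarrow> X i l = e * Y i l"
    by (rule ky_fan_equality[OF X Y n order_refl s])
      (use eq[unfolded svd_form_sum[OF svd]] in \<open>auto simp: X_def Y_def\<close>)
  have ee: "cnj e * e = 1" using mult_cnj_self[of e] e by (simp add: mult.commute)
  \<comment> \<open>The coefficients \<open>cnj (Y j l)\<close> express \<open>u l\<close> in the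
    basis \<open>y\<close>. Applying them to \<open>x\<close>, up to the phase, makes the pairs
    \<open>v' l\<close>, \<open>u l\<close> have trace \<open>cnj e\<close> times that of
    \<open>x\<close>, \<open>y\<close>.\<close>
  define v' where "v' = (\<lambda>l p. cnj e * (\<Sum>j<n. cnj (Y j l) * x j p))"
  have "cip n (v' l) (v' m) = gram n Y m l" for l m
  proof -
    have "cip n (v' l) (v' m)
        = (cnj e * e) * (\<Sum>j<n. \<Sum>i<n. Y i m * cnj (Y j l) * cip n (x j) (x i))"
      unfolding v'_def cip_linear by (simp add: sum_distrib_left mult_ac)
    also have "\<dots> = (\<Sum>j<n. \<Sum>i<n. if i = j then Y i m * cnj (Y j l) else 0)"
      unfolding ee mult_1 by (intro sum.cong refl) (simp add: onsD[OF x])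
    finally show ?thesis by (simp add: gram_def)
  qed
  then have v': "ons n n v'" unfolding ons_def by (auto simp: gram_basis[OF Y])
  have v'_eq: "v' l p = v l p" if "l < n" "p < n" "s l > 0" for l p
  proof -
    have "cnj e * (cnj (Y j l) * x j p) = cip n (v l) (x j) * x j p" if "j < n" for j
    proof -
      have "cip n (v l) (x j) = cnj (X j l)" unfolding X_def by (rule cip_commute)
      then show ?thesis by (simp add: XY[OF that \<open>l < n\<close> \<open>s l > 0\<close>] mult.assoc)
    qed
    then have "v' l p = (\<Sum>j<n. cip n (v l) (x j) * x j p)"
      unfolding v'_def sum_distrib_left by (intro sum.cong refl) auto
    then show ?thesis using basis_expansion[OF x that(2)] by simp
  qed
  have "mv a n (v' i) p = of_real (s i) * u i p" if "i < n" "p < n" for i p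
  proof (cases "s i > 0")
    case True
    have "mv a n (v' i) = mv a n (v i)" using v'_eq[OF \<open>i < n\<close> _ True] by (rule mv_cong)
    then show ?thesis using svd that by (simp add: svd_def)
  next
    case False
    then have "s i = 0" using s that by (auto simp: nonneg_decr_def intro: antisym)
    \<comment> \<open>When \<open>s i = 0\<close>, the vector \<open>v' i\<close> must lie in the
      kernel: it is orthogonal to each \<open>v l\<close> with \<open>s l > 0\<close>, as that
      vector coincides with \<open>v' l\<close>.\<close>
    have "cip n (v' i) (v l) * of_real (s l) = 0" if "l < n" for l
    proof (cases "s l > 0")
      case True
      then have "cip n (v' i) (v l) = cip n (v' i) (v' l)"
        using v'_eq[OF \<open>l < n\<close>] by (intro cip_cong) auto
      also have "\<dots> = 0" using onsD[OF v' \<open>i < n\<close> \<open>l < n\<close>] True \<open>s i = 0\<close> by auto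
      finally show ?thesis by simp
    next
      case False
      then show ?thesis using s that by (auto simp: nonneg_decr_def intro: antisym)
    qed
    then have "mv a n (v' i) p = 0"
      unfolding svd_apply[OF svd \<open>p < n\<close>] by (intro sum.neutral) auto
    then show ?thesis by (simp add: \<open>s i = 0\<close>)
  qed
  then have "svd n a u s v'" using u v' by (simp add: svd_def)
  moreover have "(\<Sum>l<n. cip n (v' l) (u l)) = 0"
  proof -
    have "(\<Sum>l<n. cip n (v' l) (u l)) = (\<Sum>l<n. \<Sum>j<n. cnj e * (cip n (x j) (u l) * cnj (Y j l)))"
      unfolding v'_def cip_linear by (simp add: sum_distrib_left mult_ac)
    also have "\<dots> = (\<Sum>j<n. \<Sum>l<n. cnj e * (cip n (x j) (u l) * cnj (Y j l)))" by (rule sum.swap)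
    also have "\<dots> = (\<Sum>j<n. cnj e * cip n (x j) (y j))"
      unfolding Y_def sum_distrib_left[symmetric] parseval[OF u] ..
    finally show ?thesis
      using tr by (simp only: traceless_def sum_distrib_left[symmetric] mult_zero_right)
  qed
  ultimately show ?thesis unfolding traceless_def by blast
qed

section \<open>Averaging the diagonal\<close>

lemma unit_orthogonal:
  fixes p q :: real
  obtains c d where "c\<^sup>2 + d\<^sup>2 = 1" "c * p + d * q = 0"
proof (cases "p = 0 \<and> q = 0")
  case True
  then show ?thesis using that[of 1 0] by simp
next
  case False
  then have r: "p\<^sup>2 + q\<^sup>2 > 0" by (simp add: sum_power2_gt_zero_iff)
  have "(q / sqrt (p\<^sup>2 + q\<^sup>2))\<^sup>2 + (- p / sqrt (p\<^sup>2 + q\<^sup>2))\<^sup>2 = (q\<^sup>2 + p\<^sup>2) / (p\<^sup>2 + q\<^sup>2)"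
    using r by (simp add: power_divide add_divide_distrib)
  also have "\<dots> = 1" using r by (subst add.commute) (rule divide_self, linarith)
  finally show ?thesis by (rule that) (simp add: mult.commute)
qed

text \<open>The left side is a diagonal entry after a rotation. With \<open>w\<close> half the
  difference of \<open>t1\<close> and \<open>t2\<close>, it is the mean plus
  \<open>(C^2 - S^2) w + C S h\<close>, where \<open>h = cnj e * b + e * c\<close>. The phase makes
  \<open>h\<close> a real multiple of \<open>w\<close>; the angle then cancels the rest.\<close>

lemma averaging_rotation:
  fixes t1 t2 b c :: complex
  obtains e and C S :: real where "cmod e = 1" "C\<^sup>2 + S\<^sup>2 = 1"
    "of_real (C\<^sup>2) * t1 + of_real (S\<^sup>2) * t2 + of_real (C * S) * (cnj e * b + e * c) = (t1 + t2) / 2"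
proof (cases "t1 = t2")
  case True
  then show ?thesis using that[of 1 1 0] by simp
next
  case False
  define w where "w = (t1 - t2) / 2"
  have "w \<noteq> 0" using False by (simp add: w_def)
  \<comment> \<open>The imaginary part of \<open>h * cnj w\<close> is a real linear form in the two
    coordinates of \<open>e\<close>, so some unit \<open>e\<close> annihilates it.\<close>
  obtain x y where xy: "x\<^sup>2 + y\<^sup>2 = 1"
    "x * Im ((b + c) * cnj w) + y * Im (\<i> * (c - b) * cnj w) = 0"
    by (rule unit_orthogonal)
  define e where "e = Complex x y"
  have e: "cmod e = 1" using xy(1) by (simp add: e_def cmod_def)
  define h where "h = cnj e * b + e * c"
  define r where "r = Re (h * cnj w) / (cmod w)\<^sup>2"
  have h_xy: "h = of_real x * (b + c) + of_real y * (\<i> * (c - b))"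
    by (simp add: h_def e_def complex_eq_iff algebra_simps)
  have "Im (h * cnj w) = x * Im ((b + c) * cnj w) + y * Im (\<i> * (c - b) * cnj w)"
    unfolding h_xy by (simp add: algebra_simps)
  then have "Im (h * cnj w) = 0" using xy(2) by simp
  then have "h * cnj w = of_real (r * (cmod w)\<^sup>2)"
    using \<open>w \<noteq> 0\<close> by (simp add: r_def complex_eq_iff)
  then have "h * cnj w = of_real r * w * cnj w"
    by (simp add: mult_cnj_self mult.assoc)
  then have h: "h = of_real r * w" using \<open>w \<noteq> 0\<close> by simp
  \<comment> \<open>Here \<open>p\<close> and \<open>q\<close> are cosine and sine of the doubled
    angle, hence \<open>C^2 - S^2 = p\<close> and \<open>C * S = q / 2\<close>.\<close>
  obtain p q where pq: "p\<^sup>2 + q\<^sup>2 = 1" "p * 1 + q * (r / 2) = 0"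
    by (rule unit_orthogonal)
  then obtain \<theta> where \<theta>: "p = cos \<theta>" "q = sin \<theta>"
    using sincos_total_2pi by metis
  define C where "C = cos (\<theta> / 2)"
  define S where "S = sin (\<theta> / 2)"
  have CS: "C\<^sup>2 + S\<^sup>2 = 1" by (simp add: C_def S_def)
  have "p = C\<^sup>2 - S\<^sup>2" "q = 2 * S * C"
    using cos_double[of "\<theta> / 2"] sin_double[of "\<theta> / 2"] by (simp_all add: \<theta> C_def S_def)
  then have "C\<^sup>2 - S\<^sup>2 + C * S * r = 0" using pq(2) by (simp add: mult_ac)
  moreover have "of_real (C\<^sup>2) * t1 + of_real (S\<^sup>2) * t2 + of_real (C * S) * h
      = of_real (C\<^sup>2 + S\<^sup>2) * ((t1 + t2) / 2) + of_real (C\<^sup>2 - S\<^sup>2 + C * S * r) * w"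
    by (simp add: h w_def field_simps)
  ultimately show ?thesis using that[OF e CS] CS by (simp add: h_def)
qed

lemma parallelogram_half:
  "(cmod a)\<^sup>2 + (cmod b)\<^sup>2 = 2 * (cmod ((a + b) / 2))\<^sup>2 + 2 * (cmod ((a - b) / 2))\<^sup>2"
  unfolding cmod_power2 by (simp add: power2_eq_square field_simps)

lemma sum_eq2:
  assumes "finite A" "i \<in> A" "j \<in> A" "i \<noteq> j"
    and "\<And>l. l \<in> A \<Longrightarrow> l \<noteq> i \<Longrightarrow> l \<noteq> j \<Longrightarrow> f l = g l" and "f i + f j = g i + g j"
  shows "sum f A = sum g A"
proof -
  have "sum f (A - {i} - {j}) = sum g (A - {i} - {j})"
    using assms(5) by (intro sum.cong) auto
  then show ?thesis using assms(6) by (simp add: sum_remove2[OF assms(1-4)])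
qed

text \<open>Rotating both bases simultaneously inside a singular subspace preserves the decomposition, so a
  minimiser of \<open>\<Sum>i. \<bar>\<langle>v\<^sub>i, u\<^sub>i\<rangle>\<bar>\<^sup>2\<close> has equal \<open>\<langle>v\<^sub>i, u\<^sub>i\<rangle>\<close> within each singular subspace: otherwise two
  of them could be replaced by their mean.\<close>

lemma exists_averaged_svd:
  assumes "svd n a u0 s v0" "traceless n n v0 u0"
  obtains u v where "svd n a u s v" "traceless n n v u"
    "\<And>i j. i < n \<Longrightarrow> j < n \<Longrightarrow> s i = s j \<Longrightarrow> cip n (v i) (u i) = cip n (v j) (u j)"
proof -
  \<comment> \<open>The sign turns the maximiser supplied by compactness into a minimiser.\<close>
  define F where "F v u = - (\<Sum>i<n. (cmod (cip n (v i) (u i)))\<^sup>2)" for v u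
  define P where "P v u \<longleftrightarrow> (\<forall>i<n. \<forall>l<n. mv a n (v i) l = of_real (s i) * u i l)
    \<and> traceless n n v u" for v u
  have svd_iff: "svd n a u s v \<and> traceless n n v u \<longleftrightarrow> ons n n v \<and> ons n n u \<and> P v u" for u v
    by (auto simp: svd_def P_def)
  have closed: "closed {z. P (fst z) (snd z)}"
    unfolding P_def traceless_def cip_def mv_def
    by (intro closed_Collect_conj closed_Collect_all closed_Collect_imp open_Collect_const
        closed_Collect_eq continuous_on_sum continuous_on_mult continuous_on_const
        continuous_on_cnj continuous_on_pair_coordinates)
  have cont: "continuous_on UNIV (\<lambda>z. F (fst z) (snd z))"
    unfolding F_def cip_def
    by (intro continuous_on_minus continuous_on_power continuous_on_norm continuous_on_sum
        continuous_on_mult continuous_on_cnj continuous_on_pair_coordinates)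
  obtain v u where v: "ons n n v" and u: "ons n n u" and P: "P v u"
    and max: "\<And>v' u'. ons n n v' \<Longrightarrow> ons n n u' \<Longrightarrow> P v' u' \<Longrightarrow> F v' u' \<le> F v u"
  proof (rule max_over_ons_pairs[where F = F and P = P and n = n and k = n])
    show "F x y = F x' y' \<and> P x y = P x' y'"
      if eq: "\<And>i l. i < n \<Longrightarrow> l < n \<Longrightarrow> x i l = x' i l \<and> y i l = y' i l" for x y x' y'
    proof -
      have "cip n (x i) (y i) = cip n (x' i) (y' i)" if "i < n" for i
        using that eq by (intro cip_cong) auto
      moreover have "mv a n (x i) = mv a n (x' i)" if "i < n" for i
        using that eq by (intro mv_cong) auto
      ultimately show ?thesis using eq by (auto simp: F_def P_def traceless_def)
    qed
    show "\<exists>x y. ons n n x \<and> ons n n y \<and> P x y"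
      using assms svd_iff by blast
  qed (use closed cont in auto)
  show ?thesis
  proof (rule that[of u v])
    show "svd n a u s v" "traceless n n v u" using svd_iff u v P by blast+
    fix i j assume ij: "i < n" "j < n" "s i = s j"
    show "cip n (v i) (u i) = cip n (v j) (u j)"
    proof (rule ccontr)
      let ?t = "\<lambda>i. cip n (v i) (u i)"
      assume ne: "?t i \<noteq> ?t j"
      then have "i \<noteq> j" by auto
      obtain e C S where e: "cmod e = 1" and CS: "C\<^sup>2 + S\<^sup>2 = 1" and avg:
        "of_real (C\<^sup>2) * ?t i + of_real (S\<^sup>2) * ?t j
          + of_real (C * S) * (cnj e * cip n (v i) (u j) + e * cip n (v j) (u i)) = (?t i + ?t j) / 2"
        by (rule averaging_rotation)
      define R where "R = rot i j (of_real C) (e * of_real S) (- cnj e * of_real S) (of_real C)"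
      have ee: "e * cnj e = 1" using mult_cnj_self[of e] e by simp
      have ons_R: "ons n n (R x)" if "ons n n x" for x
        unfolding R_def using ons_rotation[OF that ij(1,2) \<open>i \<noteq> j\<close> e CS] .
      have R_other: "R x l = x l" if "l \<noteq> i" "l \<noteq> j" for x l
        unfolding R_def using rot_simps(3)[OF \<open>i \<noteq> j\<close> that] .
      have "cip n (R v i) (R u i) = of_real (C\<^sup>2) * ?t i + of_real (S\<^sup>2) * (e * cnj e) * ?t j
          + of_real (C * S) * (cnj e * cip n (v i) (u j) + e * cip n (v j) (u i))"
        unfolding R_def rot_simps[OF \<open>i \<noteq> j\<close>] cip_linear
        by (simp add: power2_eq_square algebra_simps)
      then have Ri: "cip n (R v i) (R u i) = (?t i + ?t j) / 2" using avg ee by simp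
      have "cip n (R v j) (R u j) = of_real (S\<^sup>2) * (e * cnj e) * ?t i + of_real (C\<^sup>2) * ?t j
          - of_real (C * S) * (cnj e * cip n (v i) (u j) + e * cip n (v j) (u i))"
        unfolding R_def rot_simps[OF \<open>i \<noteq> j\<close>] cip_linear
        by (simp add: power2_eq_square algebra_simps)
      \<comment> \<open>The common rotation preserves the trace of the 2 by 2 block, so the second
        entry is the mean as well.\<close>
      also have "\<dots> = of_real (C\<^sup>2 + S\<^sup>2) * (?t i + ?t j) - (of_real (C\<^sup>2) * ?t i + of_real (S\<^sup>2) * ?t j
          + of_real (C * S) * (cnj e * cip n (v i) (u j) + e * cip n (v j) (u i)))"
        unfolding ee by (simp add: algebra_simps)
      finally have Rj: "cip n (R v j) (R u j) = (?t i + ?t j) / 2" unfolding avg CS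
        by (simp add: field_simps)
      \<comment> \<open>As \<open>s i = s j\<close>, equal combinations of the right and of the left
        singular vectors are again paired.\<close>
      have sing: "mv a n (R v p) l = of_real (s p) * R u p l" if "p < n" "l < n" for p l
      proof -
        have vu: "mv a n (v q) l = of_real (s q) * u q l" if "q < n" for q
          using P that \<open>l < n\<close> by (simp add: P_def)
        consider "p = i" | "p = j" | "p \<noteq> i" "p \<noteq> j" by blast
        then show ?thesis
        proof cases
          case 1
          then show ?thesis unfolding R_def
            by (simp only: rot_simps[OF \<open>i \<noteq> j\<close>] mv_linear vu ij distrib_left mult.left_commute)
        next
          case 2
          then show ?thesis unfolding R_def
            by (simp only: rot_simps[OF \<open>i \<noteq> j\<close>] mv_linear vu ij distrib_left mult.left_commute)
        qed (simp add: R_other vu that)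
      qed
      have "(\<Sum>l<n. cip n (R v l) (R u l)) = (\<Sum>l<n. ?t l)"
        using ij(1,2) \<open>i \<noteq> j\<close> by (intro sum_eq2[of _ i j]) (auto simp: R_other Ri Rj)
      then have "P (R v) (R u)"
        using P sing by (simp add: P_def traceless_def)
      then have "F (R v) (R u) \<le> F v u" using max ons_R u v by blast
      then have "- (cmod (cip n (R v i) (R u i)))\<^sup>2 + - (cmod (cip n (R v j) (R u j)))\<^sup>2
          \<le> - (cmod (?t i))\<^sup>2 + - (cmod (?t j))\<^sup>2"
        using ij(1,2) \<open>i \<noteq> j\<close>
        by (intro two_terms_le[where A = "{..<n}" and f = "\<lambda>i. - (cmod (cip n (R v i) (R u i)))\<^sup>2"
              and g = "\<lambda>i. - (cmod (?t i))\<^sup>2"]) (auto simp: F_def R_other sum_negf)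
      \<comment> \<open>Averaging two distinct numbers strictly lowers the sum of their squared
        moduli.\<close>
      moreover have "(cmod ((?t i - ?t j) / 2))\<^sup>2 > 0" using ne by simp
      ultimately show False
        unfolding Ri Rj using parallelogram_half[of "?t i" "?t j"] by linarith
    qed
  qed
qed

text \<open>After averaging, the diagonal is constant on each run of equal singular values. By
  induction the entries before \<open>i\<close> vanish, so the zero leading trace at the end
  \<open>k\<close> of the run of \<open>i\<close> reads \<open>(k - i)\<close> times the
  \<open>i\<close>-th entry.\<close>

lemma svd_zero_diagonal:
  assumes svd0: "svd n a u0 s v0" and s: "nonneg_decr n s" and n: "0 < n"
    and ext: "\<And>k. 0 < k \<Longrightarrow> k \<le> n \<Longrightarrow> \<exists>x y. ons n k x \<and> ons n k y \<and> traceless n k x y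
      \<and> cmod (\<Sum>i<k. cip n (mv a n (x i)) (y i)) = (\<Sum>l<k. s l)"
  shows "\<exists>u v. svd n a u s v \<and> (\<forall>i<n. cip n (v i) (u i) = 0)"
proof -
  obtain v1 where "svd n a u0 s v1" "traceless n n v1 u0"
    using exists_traceless_svd[OF svd0 s n] ext[OF n order_refl] by blast
  then obtain u v where svd: "svd n a u s v" and tr: "traceless n n v u"
    and avg: "\<And>i j. i < n \<Longrightarrow> j < n \<Longrightarrow> s i = s j \<Longrightarrow> cip n (v i) (u i) = cip n (v j) (u j)"
    by (rule exists_averaged_svd) blast
  have "cip n (v i) (u i) = 0" if "i < n" for i
    using that
  proof (induction i rule: less_induct)
    case (less i)
    \<comment> \<open>The first index after \<open>i\<close> where \<open>s\<close> drops, or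
      \<open>n\<close> when it never does.\<close>
    define k where "k = (LEAST k. i < k \<and> (k = n \<or> s k < s i))"
    have k: "i < k" "k = n \<or> s k < s i" and "k \<le> n"
      using LeastI[of "\<lambda>k. i < k \<and> (k = n \<or> s k < s i)" n]
        Least_le[of "\<lambda>k. i < k \<and> (k = n \<or> s k < s i)" n] less.prems
      unfolding k_def by auto
    have s_eq: "s l = s i" if "i \<le> l" "l < k" for l
    proof (rule antisym)
      show "s l \<le> s i" using s that \<open>k \<le> n\<close> by (auto simp: nonneg_decr_def)
      have "\<not> (i < l \<and> (l = n \<or> s l < s i))"
        using not_less_Least[of l "\<lambda>k. i < k \<and> (k = n \<or> s k < s i)"] that(2) unfolding k_def by blast
      then show "s i \<le> s l" using that by (cases "l = i") auto
    qed
    have "traceless n k v u"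
    proof (cases "k = n")
      case False
      then have "k < n" "s k < s (k - 1)" using k \<open>k \<le> n\<close> s_eq[of "k - 1"] by auto
      moreover have "0 < k" using k(1) by simp
      ultimately show ?thesis
        using traceless_leading_block[OF svd s] ext[of k] \<open>k \<le> n\<close> by blast
    qed (use tr in simp)
    have "(\<Sum>l<k. cip n (v l) (u l)) = (\<Sum>l=i..<k. cip n (v l) (u l))"
      using less.IH less.prems k(1) by (intro sum.mono_neutral_right) auto
    also have "\<dots> = (\<Sum>l=i..<k. cip n (v i) (u i))"
      using less.prems \<open>k \<le> n\<close> by (intro sum.cong refl avg s_eq) auto
    also have "\<dots> = of_nat (k - i) * cip n (v i) (u i)" by simp
    finally have "of_nat (k - i) * cip n (v i) (u i) = 0"
      using \<open>traceless n k v u\<close> by (simp add: traceless_def)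
    then show ?case using k(1) by simp
  qed
  then show ?thesis using svd by blast
qed

section \<open>Translation to matrices\<close>

lemma svd_cong:
  assumes "svd n a u s v"
    and "\<And>i l. i < n \<Longrightarrow> l < n \<Longrightarrow> u' i l = u i l" "\<And>i l. i < n \<Longrightarrow> l < n \<Longrightarrow> v' i l = v i l"
  shows "svd n a u' s v'"
proof -
  have "cip n (u' i) (u' j) = cip n (u i) (u j)" "cip n (v' i) (v' j) = cip n (v i) (v j)"
    "mv a n (v' i) = mv a n (v i)" if "i < n" "j < n" for i j
    using assms(2,3) that by (auto intro!: cip_cong mv_cong)
  then show ?thesis using assms by (simp add: svd_def ons_def)
qed

section \<open>Adjoints and unitary matrices\<close>

lemma adjoint_dim [simp]:
  "dim_row (mat_adjoint A) = dim_col A" "dim_col (mat_adjoint A) = dim_row A"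
  by (simp_all add: mat_adjoint_def)

lemma adjoint_carrier [simp]: "A \<in> carrier_mat m n \<Longrightarrow> mat_adjoint A \<in> carrier_mat n m"
  by (auto simp: mat_adjoint_def)

lemma adjoint_index [simp]:
  fixes A :: "complex mat"
  assumes "A \<in> carrier_mat m n" "i < n" "j < m"
  shows "mat_adjoint A $$ (i, j) = cnj (A $$ (j, i))"
  using assms unfolding mat_adjoint_def by (auto simp: mat_of_rows_index conjugate_complex_def)

lemma mult_index:
  assumes "A \<in> carrier_mat m n" "B \<in> carrier_mat n p" "i < m" "j < p"
  shows "(A * B) $$ (i, j) = (\<Sum>l<n. A $$ (i, l) * B $$ (l, j))"
  using assms by (simp add: scalar_prod_def atLeast0LessThan)

lemma adjoint_mult:
  fixes A B :: "complex mat"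
  assumes "A \<in> carrier_mat m n" "B \<in> carrier_mat n p"
  shows "mat_adjoint (A * B) = mat_adjoint B * mat_adjoint A"
proof (rule eq_matI)
  have C: "A * B \<in> carrier_mat m p" using assms by simp
  note adj = adjoint_carrier[OF assms(1)] adjoint_carrier[OF assms(2)] adjoint_carrier[OF C]
  fix i j assume "i < dim_row (mat_adjoint B * mat_adjoint A)" "j < dim_col (mat_adjoint B * mat_adjoint A)"
  then have ij: "i < p" "j < m" using adj by auto
  have "mat_adjoint (A * B) $$ (i, j) = cnj (\<Sum>l<n. A $$ (j, l) * B $$ (l, i))"
    by (simp only: adjoint_index[OF C ij] mult_index[OF assms ij(2,1)])
  also have "\<dots> = (\<Sum>l<n. mat_adjoint B $$ (i, l) * mat_adjoint A $$ (l, j))"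
    unfolding cnj_sum using ij assms by (intro sum.cong refl) (simp add: mult.commute)
  also have "\<dots> = (mat_adjoint B * mat_adjoint A) $$ (i, j)"
    by (rule mult_index[OF adj(2,1) ij, symmetric])
  finally show "mat_adjoint (A * B) $$ (i, j) = (mat_adjoint B * mat_adjoint A) $$ (i, j)" .
qed simp_all

lemma adjoint_adjoint:
  fixes A :: "complex mat"
  assumes "A \<in> carrier_mat m n"
  shows "mat_adjoint (mat_adjoint A) = A"
proof (rule eq_matI)
  note adj = adjoint_carrier[OF assms] adjoint_carrier[OF adjoint_carrier[OF assms]]
  fix i j assume "i < dim_row A" "j < dim_col A"
  then have ij: "i < m" "j < n" using assms by auto
  show "mat_adjoint (mat_adjoint A) $$ (i, j) = A $$ (i, j)"
    using adjoint_index[OF adj(1) ij] adjoint_index[OF assms ij(2,1)] by simp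
qed simp_all

lemma adjoint_real_diag: "mat_adjoint (mat_diag n (\<lambda>i. complex_of_real (f i))) = mat_diag n (\<lambda>i. of_real (f i))"
proof (rule eq_matI)
  fix i j
  let ?D = "mat_diag n (\<lambda>i. complex_of_real (f i))"
  assume "i < dim_row ?D" "j < dim_col ?D"
  then have ij: "i < n" "j < n" by (auto simp: mat_diag_def)
  have "?D \<in> carrier_mat n n" by simp
  from adjoint_index[OF this ij] show "mat_adjoint ?D $$ (i, j) = ?D $$ (i, j)"
    using ij by (auto simp: mat_diag_def)
qed (simp_all add: mat_diag_def)

lemma adjoint_self_mult_index:
  fixes U V :: "complex mat"
  assumes "U \<in> carrier_mat n n" "V \<in> carrier_mat n n" "i < n" "j < n"
  shows "(mat_adjoint U * V) $$ (i, j) = cip n (\<lambda>l. V $$ (l, j)) (\<lambda>l. U $$ (l, i))"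
  unfolding mult_index[OF adjoint_carrier[OF assms(1)] assms(2-4)] cip_def
  using assms by (intro sum.cong refl) (simp add: mult.commute)

text \<open>The product \<open>mat_adjoint U * U\<close> is the Gram matrix of the columns; the
  other identity holds as a one-sided inverse of a square matrix is two-sided.\<close>

lemma unitary_iff_ons:
  assumes "U \<in> carrier_mat n n"
  shows "U \<in> unitary_group n \<longleftrightarrow> ons n n (\<lambda>i l. U $$ (l, i))"
proof
  assume "U \<in> unitary_group n"
  then have "(mat_adjoint U * U) $$ (i, j) = (1\<^sub>m n) $$ (i, j)" for i j
    by (simp add: unitary_group_def)
  then have "cip n (\<lambda>l. U $$ (l, j)) (\<lambda>l. U $$ (l, i)) = (1\<^sub>m n) $$ (i, j)"
    if "i < n" "j < n" for i j
    using adjoint_self_mult_index[OF assms assms that] by simp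
  then show "ons n n (\<lambda>i l. U $$ (l, i))" by (auto simp: ons_def)
next
  assume ons: "ons n n (\<lambda>i l. U $$ (l, i))"
  have U': "mat_adjoint U \<in> carrier_mat n n" using assms by simp
  have "mat_adjoint U * U = 1\<^sub>m n"
  proof (rule eq_matI)
    fix i j assume "i < dim_row (1\<^sub>m n :: complex mat)" "j < dim_col (1\<^sub>m n :: complex mat)"
    then have ij: "i < n" "j < n" by auto
    then show "(mat_adjoint U * U) $$ (i, j) = 1\<^sub>m n $$ (i, j)"
      unfolding adjoint_self_mult_index[OF assms assms ij] using onsD[OF ons] by auto
  qed (use assms in auto)
  moreover from this have "U * mat_adjoint U = 1\<^sub>m n"
    by (rule mat_mult_left_right_inverse[OF U' assms])
  ultimately show "U \<in> unitary_group n" using assms by (simp add: unitary_group_def)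
qed

text \<open>The singular vector relations are the columns of \<open>A V = U S\<close>; multiplying
  by the adjoint of the unitary \<open>V\<close>, or by \<open>V\<close>, passes between this and
  the factorization of \<open>A\<close>.\<close>

lemma svd_iff_matrix_factorization:
  assumes A: "A \<in> carrier_mat n n" and U: "U \<in> carrier_mat n n" and V: "V \<in> carrier_mat n n"
  shows "svd n (\<lambda>l m. A $$ (l, m)) (\<lambda>i l. U $$ (l, i)) s (\<lambda>i l. V $$ (l, i)) \<longleftrightarrow>
    U \<in> unitary_group n \<and> V \<in> unitary_group n \<and>
    A = U * mat_diag n (\<lambda>i. complex_of_real (s i)) * mat_adjoint V"
    (is "?L \<longleftrightarrow> _ \<and> _ \<and> A = U * ?S * _")
proof -
  have S: "?S \<in> carrier_mat n n" and US: "U * ?S \<in> carrier_mat n n"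
    and V': "mat_adjoint V \<in> carrier_mat n n" using U V by auto
  have AV: "(A * V) $$ (l, i) = mv (\<lambda>l m. A $$ (l, m)) n (\<lambda>l. V $$ (l, i)) l" if "l < n" "i < n" for l i
    unfolding mult_index[OF A V that] mv_def ..
  have US_index: "(U * ?S) $$ (l, i) = of_real (s i) * U $$ (l, i)" if "l < n" "i < n" for l i
    using that by (simp add: mat_diag_mult_right[OF U] mult.commute)
  have "(\<forall>i<n. \<forall>l<n. mv (\<lambda>l m. A $$ (l, m)) n (\<lambda>l. V $$ (l, i)) l = of_real (s i) * U $$ (l, i))
      \<longleftrightarrow> A * V = U * ?S"
    (is "?E \<longleftrightarrow> _")
  proof
    assume ?E
    show "A * V = U * ?S"
    proof (rule eq_matI)
      fix l i assume "l < dim_row (U * ?S)" "i < dim_col (U * ?S)"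
      then have "l < n" "i < n" using US by auto
      then show "(A * V) $$ (l, i) = (U * ?S) $$ (l, i)"
        using AV US_index \<open>?E\<close> by auto
    qed (use A U V carrier_matD[OF S] in auto)
  qed (use AV US_index in metis)
  moreover have "A * V = U * ?S \<longleftrightarrow> A = U * ?S * mat_adjoint V" if "V \<in> unitary_group n"
  proof
    assume "A * V = U * ?S"
    then have "U * ?S * mat_adjoint V = A * (V * mat_adjoint V)"
      using assoc_mult_mat[OF A V V'] by simp
    then show "A = U * ?S * mat_adjoint V" using that A by (simp add: unitary_group_def)
  next
    assume eq: "A = U * ?S * mat_adjoint V"
    have "A * V = U * ?S * (mat_adjoint V * V)"
      by (subst eq) (rule assoc_mult_mat[OF US V' V])
    also have "\<dots> = U * ?S" using that right_mult_one_mat[OF US] by (simp add: unitary_group_def)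
    finally show "A * V = U * ?S" .
  qed
  ultimately show ?thesis
    unfolding svd_def unitary_iff_ons[OF U] unitary_iff_ons[OF V] by blast
qed

section \<open>The list of singular values\<close>

lemma proots_linear_factors:
  fixes as :: "complex list"
  shows "proots (\<Prod>a\<leftarrow>as. [:- a, 1:]) = mset as"
proof (induction as)
  case (Cons a as)
  have "(\<Prod>a\<leftarrow>as. [:- a, 1:]) \<noteq> 0" by (auto simp: prod_list_zero_iff)
  then show ?case using Cons by (simp add: proots_mult del: mult_pCons_left)
qed simp

text \<open>\<open>A\<^sup>* A = V S\<^sup>2 V\<^sup>*\<close> is similar to a diagonal matrix, so
  the roots of its characteristic polynomial are the \<open>(s i)^2\<close>.\<close>

lemma singular_values_eq:
  assumes A: "A \<in> carrier_mat n n"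
    and svd: "svd n (\<lambda>l m. A $$ (l, m)) u s v" and s: "nonneg_decr n s"
  shows "singular_values A = map s [0..<n]"
proof -
  define U where "U = Matrix.mat n n (\<lambda>(l, i). u i l)"
  define V where "V = Matrix.mat n n (\<lambda>(l, i). v i l)"
  define S where "S = mat_diag n (\<lambda>i. complex_of_real (s i))"
  have U: "U \<in> carrier_mat n n" and V: "V \<in> carrier_mat n n" and S: "S \<in> carrier_mat n n"
    by (auto simp: U_def V_def S_def)
  have "svd n (\<lambda>l m. A $$ (l, m)) (\<lambda>i l. U $$ (l, i)) s (\<lambda>i l. V $$ (l, i))"
    by (rule svd_cong[OF svd]) (auto simp: U_def V_def)
  then have unit: "U \<in> unitary_group n" "V \<in> unitary_group n" and eq: "A = U * S * mat_adjoint V"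
    using svd_iff_matrix_factorization[OF A U V] by (auto simp: S_def)
  have adj: "mat_adjoint U \<in> carrier_mat n n" "mat_adjoint V \<in> carrier_mat n n" using U V by auto
  have US: "U * S \<in> carrier_mat n n" using U S by simp
  have SS: "S * S = mat_diag n (\<lambda>i. complex_of_real ((s i)\<^sup>2))"
    unfolding S_def by (simp add: power2_eq_square)
  have "mat_adjoint A = V * (S * mat_adjoint U)"
    unfolding eq adjoint_mult[OF US adj(2)] adjoint_mult[OF U S] adjoint_adjoint[OF V]
    by (simp add: S_def adjoint_real_diag)
  then have "mat_adjoint A * A = V * (S * mat_adjoint U) * (U * S * mat_adjoint V)"
    using eq by simp
  also have "\<dots> = V * (S * ((mat_adjoint U * U) * (S * mat_adjoint V)))"
    using U V S adj by (simp add: assoc_mult_mat[of _ n n _ n _ n])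
  also have "\<dots> = V * (S * S) * mat_adjoint V"
    using unit U V S adj by (simp add: unitary_group_def assoc_mult_mat[of _ n n _ n _ n])
  finally have AA: "mat_adjoint A * A = V * (S * S) * mat_adjoint V" .
  have "similar_mat (mat_adjoint A * A) (S * S)"
  proof (rule similar_matI)
    show "{mat_adjoint A * A, S * S, V, mat_adjoint V} \<subseteq> carrier_mat n n"
      using A V S adjoint_carrier[OF A] adj by auto
  qed (use unit AA in \<open>auto simp: unitary_group_def\<close>)
  then have "char_poly (mat_adjoint A * A) = char_poly (S * S)" by (rule char_poly_similar)
  also have "\<dots> = (\<Prod>a\<leftarrow>diag_mat (S * S). [:- a, 1:])"
    unfolding SS by (intro char_poly_upper_triangular[of _ n]) (auto simp: mat_diag_def upper_triangular_def)
  also have "diag_mat (S * S) = map (\<lambda>i. complex_of_real ((s i)\<^sup>2)) [0..<n]"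
    unfolding SS by (auto simp: diag_mat_def mat_diag_def)
  finally have "proots (char_poly (mat_adjoint A * A)) = mset (map (\<lambda>i. complex_of_real ((s i)\<^sup>2)) [0..<n])"
    by (simp only: proots_linear_factors)
  then have "image_mset (\<lambda>z. sqrt (Re z)) (proots (char_poly (mat_adjoint A * A)))
      = mset (map (\<lambda>i. sqrt ((s i)\<^sup>2)) [0..<n])"
    by (simp add: multiset.map_comp comp_def)
  also have "map (\<lambda>i. sqrt ((s i)\<^sup>2)) [0..<n] = map s [0..<n]"
    using s by (auto simp: nonneg_decr_def)
  \<comment> \<open>The reversed list is ascending, so sorting leaves it unchanged and the outer
    \<open>rev\<close> restores the order.\<close>
  also have "mset (map s [0..<n]) = mset (rev (map s [0..<n]))" by (rule mset_rev[symmetric])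
  finally have "singular_values A = rev (sort (rev (map s [0..<n])))"
    unfolding singular_values_def by (simp only: sorted_list_of_multiset_mset)
  moreover have "sorted (rev (map s [0..<n]))"
    using s by (auto simp: sorted_rev_iff_nth_mono nonneg_decr_def)
  ultimately show ?thesis by (simp add: sorted_sort_id)
qed

lemma is_SVD_iff:
  assumes A: "A \<in> carrier_mat n n" and s: "singular_values A = map s [0..<n]"
  shows "is_SVD A U S V \<longleftrightarrow> U \<in> carrier_mat n n \<and> V \<in> carrier_mat n n
    \<and> S = mat_diag n (\<lambda>i. complex_of_real (s i))
    \<and> svd n (\<lambda>l m. A $$ (l, m)) (\<lambda>i l. U $$ (l, i)) s (\<lambda>i l. V $$ (l, i))"
proof -
  have "mat_diag n (\<lambda>i. complex_of_real (singular_values A ! i)) = mat_diag n (\<lambda>i. of_real (s i))"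
    unfolding s by (auto simp: mat_diag_def)
  moreover have "W \<in> carrier_mat n n" if "W \<in> unitary_group n" for W
    using that by (simp add: unitary_group_def)
  ultimately show ?thesis
    using A svd_iff_matrix_factorization[OF A, of U V s] by (auto simp: is_SVD_def)
qed

section \<open>The discrepancy seminorm and its increments\<close>

definition discrepancy_set :: "nat \<Rightarrow> nat \<Rightarrow> (nat \<Rightarrow> nat \<Rightarrow> complex) \<Rightarrow> real set" where
  "discrepancy_set n k a = {cmod (\<Sum>i<k. cip n (mv a n (x i)) (y i)) | x y.
     ons n k x \<and> ons n k y \<and> traceless n k x y}"

lemma cscalar_prod_eq_cip:
  fixes x y :: "complex Matrix.vec"
  assumes "y \<in> carrier_vec n"
  shows "x \<bullet>c y = cip n (vec_index x) (vec_index y)"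
  using assms by (simp add: scalar_prod_def cip_def atLeast0LessThan conjugate_complex_def)

lemma orthonormal_family_iff:
  "orthonormal_family n k x \<longleftrightarrow> (\<forall>i<k. x i \<in> carrier_vec n) \<and> ons n k (\<lambda>i. vec_index (x i))"
proof (cases "\<forall>i<k. x i \<in> carrier_vec n")
  case True
  then have "x i \<bullet>c x j = cip n (vec_index (x i)) (vec_index (x j))" if "j < k" for i j
    using that by (intro cscalar_prod_eq_cip) auto
  then show ?thesis using True by (simp add: orthonormal_family_def ons_def)
qed (auto simp: orthonormal_family_def)

lemma discrepancy_seminorm_eq:
  assumes A: "A \<in> carrier_mat n n" and "0 < k"
  shows "discrepancy_seminorm k A = Sup (discrepancy_set n k (\<lambda>l m. A $$ (l, m)))"
proof -
  let ?a = "\<lambda>l m. A $$ (l, m)"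
  let ?D = "{cmod (\<Sum>i<k. (A *\<^sub>v x i) \<bullet>c y i) | x y.
        orthonormal_family n k x \<and> orthonormal_family n k y \<and> (\<Sum>j<k. x j \<bullet>c y j) = 0}"
  have form: "(A *\<^sub>v x) \<bullet>c y = cip n (mv ?a n (vec_index x)) (vec_index y)"
    if "x \<in> carrier_vec n" "y \<in> carrier_vec n" for x y
    unfolding cscalar_prod_eq_cip[OF that(2)] using A that
    by (intro cip_cong) (auto simp: mv_def scalar_prod_def atLeast0LessThan)
  have "?D = discrepancy_set n k ?a"
  proof (rule subset_antisym; rule subsetI)
    fix d assume "d \<in> ?D"
    then obtain x y where xy: "orthonormal_family n k x" "orthonormal_family n k y"
      "(\<Sum>j<k. x j \<bullet>c y j) = 0" "d = cmod (\<Sum>i<k. (A *\<^sub>v x i) \<bullet>c y i)" by blast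
    have "x j \<bullet>c y j = cip n (vec_index (x j)) (vec_index (y j))" if "j < k" for j
      using xy(2) that by (intro cscalar_prod_eq_cip) (simp add: orthonormal_family_iff)
    then have "traceless n k (\<lambda>i. vec_index (x i)) (\<lambda>i. vec_index (y i))"
      using xy(3) by (simp add: traceless_def)
    moreover have "d = cmod (\<Sum>i<k. cip n (mv ?a n (vec_index (x i))) (vec_index (y i)))"
      using xy by (simp add: orthonormal_family_iff form)
    ultimately show "d \<in> discrepancy_set n k ?a"
      using xy(1,2) unfolding discrepancy_set_def orthonormal_family_iff
      by (intro CollectI exI[of _ "\<lambda>i. vec_index (x i)"] exI[of _ "\<lambda>i. vec_index (y i)"]) simp
  next
    fix d assume "d \<in> discrepancy_set n k ?a"
    then obtain x y where xy: "ons n k x" "ons n k y" "traceless n k x y"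
      "d = cmod (\<Sum>i<k. cip n (mv ?a n (x i)) (y i))"
      unfolding discrepancy_set_def by blast
    let ?x = "\<lambda>i. Matrix.vec n (x i)" and ?y = "\<lambda>i. Matrix.vec n (y i)"
    have cip_vec: "cip n (vec_index (Matrix.vec n f)) (vec_index (Matrix.vec n g)) = cip n f g" for f g
      by (rule cip_cong) auto
    have "mv ?a n (vec_index (Matrix.vec n f)) = mv ?a n f" for f
      by (rule mv_cong) auto
    then have "cip n (mv ?a n (vec_index (?x i))) (vec_index (?y i)) = cip n (mv ?a n (x i)) (y i)" for i
      by (intro cip_cong) auto
    then have "d = cmod (\<Sum>i<k. (A *\<^sub>v ?x i) \<bullet>c ?y i)"
      using xy(4) by (simp add: form)
    moreover have "orthonormal_family n k ?x" "orthonormal_family n k ?y"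
      using xy(1,2) by (simp_all add: orthonormal_family_iff ons_def cip_vec)
    moreover have "(\<Sum>j<k. ?x j \<bullet>c ?y j) = 0"
      using xy(3) by (simp add: cscalar_prod_eq_cip[of _ n] cip_vec traceless_def)
    ultimately show "d \<in> ?D"
      by (intro CollectI exI[of _ ?x] exI[of _ ?y]) simp
  qed
  then show ?thesis using assms by (simp add: discrepancy_seminorm_def)
qed

text \<open>Unit vectors are paired with their cyclic shifts; for \<open>n \<ge> 2\<close> the shift
  has no fixed point, so every inner product is zero.\<close>

lemma exists_traceless_pair:
  assumes "2 \<le> n" "k \<le> n"
  shows "\<exists>x y. ons n k x \<and> ons n k y \<and> traceless n k x y"
proof -
  define p where "p i = (if Suc i = n then 0 else Suc i)" for i
  let ?x = "\<lambda>i l. if l = id i then 1 else (0::complex)"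
  let ?y = "\<lambda>i l. if l = p i then 1 else (0::complex)"
  have "ons n k ?x" using assms by (intro ons_unit) auto
  moreover have "ons n k ?y"
    using assms by (intro ons_unit) (auto simp: p_def inj_on_def split: if_splits)
  moreover have "traceless n k ?x ?y"
    unfolding traceless_def using assms by (intro sum.neutral) (auto simp: cip_unit p_def)
  ultimately show ?thesis by blast
qed

text \<open>Compactness makes the supremum a maximum and so supplies the extremal pair for the
  equality analysis.\<close>

lemma discrepancy_seminorm_attained:
  assumes A: "A \<in> carrier_mat n n" and n: "2 \<le> n" and k: "0 < k" "k \<le> n"
  obtains x y where "ons n k x" "ons n k y" "traceless n k x y"
    "discrepancy_seminorm k A = cmod (\<Sum>i<k. cip n (mv (\<lambda>l m. A $$ (l, m)) n (x i)) (y i))"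
proof -
  let ?a = "\<lambda>l m. A $$ (l, m)"
  define F where "F x y = cmod (\<Sum>i<k. cip n (mv ?a n (x i)) (y i))" for x y
  have closed: "closed {z. traceless n k (fst z) (snd z)}"
    unfolding traceless_def cip_def
    by (intro closed_Collect_eq continuous_on_sum continuous_on_mult continuous_on_const
        continuous_on_cnj continuous_on_pair_coordinates)
  have cont: "continuous_on UNIV (\<lambda>z. F (fst z) (snd z))"
    unfolding F_def cip_def mv_def
    by (intro continuous_on_norm continuous_on_sum continuous_on_mult continuous_on_const
        continuous_on_cnj continuous_on_pair_coordinates)
  obtain x y where xy: "ons n k x" "ons n k y" "traceless n k x y"
    and max: "\<And>x' y'. ons n k x' \<Longrightarrow> ons n k y' \<Longrightarrow> traceless n k x' y' \<Longrightarrow> F x' y' \<le> F x y"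
  proof (rule max_over_ons_pairs[where F = F and P = "traceless n k" and n = n and k = k])
    show "F x y = F x' y' \<and> traceless n k x y = traceless n k x' y'"
      if eq: "\<And>i l. i < k \<Longrightarrow> l < n \<Longrightarrow> x i l = x' i l \<and> y i l = y' i l" for x y x' y'
    proof -
      have "cip n (x i) (y i) = cip n (x' i) (y' i)" if "i < k" for i
        using that eq by (intro cip_cong) auto
      moreover have "cip n (mv ?a n (x i)) (y i) = cip n (mv ?a n (x' i)) (y' i)" if "i < k" for i
      proof -
        have "mv ?a n (x i) = mv ?a n (x' i)" using that eq by (intro mv_cong) auto
        then show ?thesis using that eq by (intro cip_cong) auto
      qed
      ultimately show ?thesis by (simp add: F_def traceless_def)
    qed
    show "\<exists>x y. ons n k x \<and> ons n k y \<and> traceless n k x y"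
      by (rule exists_traceless_pair[OF n k(2)])
  qed (use closed cont in auto)
  have "Sup (discrepancy_set n k ?a) = F x y"
  proof (rule cSup_eq_maximum)
    show "F x y \<in> discrepancy_set n k ?a" using xy unfolding discrepancy_set_def F_def by blast
  qed (use max in \<open>auto simp: discrepancy_set_def F_def\<close>)
  then show ?thesis
    using that[OF xy] discrepancy_seminorm_eq[OF A k(1)] by (simp add: F_def)
qed

text \<open>Telescoping from the value 0 at \<open>k = 0\<close>; entry \<open>i\<close> of the list
  is the increment from \<open>i\<close> to \<open>Suc i\<close>.\<close>

lemma discrepancy_values_eq_iff:
  assumes "A \<in> carrier_mat n n"
  shows "discrepancy_values A = map s [0..<n] \<longleftrightarrow>
    (\<forall>k. 0 < k \<longrightarrow> k \<le> n \<longrightarrow> discrepancy_seminorm k A = (\<Sum>l<k. s l))"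
proof -
  have "discrepancy_values A = map s [0..<n]
      \<longleftrightarrow> (\<forall>i<n. discrepancy_seminorm (Suc i) A - discrepancy_seminorm i A = s i)"
    using assms by (auto simp: discrepancy_values_def discrepancy_value_def list_eq_iff_nth_eq nth_upt
        simp del: upt_Suc)
  also have "\<dots> \<longleftrightarrow> (\<forall>k\<le>n. discrepancy_seminorm k A = (\<Sum>l<k. s l))" (is "?L \<longleftrightarrow> ?R")
  proof
    assume ?L
    show ?R
    proof (intro allI impI)
      fix k assume "k \<le> n"
      then show "discrepancy_seminorm k A = (\<Sum>l<k. s l)"
      proof (induction k)
        case (Suc k)
        then have "discrepancy_seminorm (Suc k) A - discrepancy_seminorm k A = s k"
          using \<open>?L\<close> Suc_le_eq by blast
        then show ?case using Suc by simp
      qed (simp add: discrepancy_seminorm_def)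
    qed
  qed simp
  also have "\<dots> \<longleftrightarrow> (\<forall>k. 0 < k \<longrightarrow> k \<le> n \<longrightarrow> discrepancy_seminorm k A = (\<Sum>l<k. s l))"
  proof -
    have "discrepancy_seminorm 0 A = (\<Sum>l<0. s l)" by (simp add: discrepancy_seminorm_def)
    then show ?thesis by (metis gr0I)
  qed
  finally show ?thesis .
qed

theorem mainTheorem3:
  fixes A :: "complex mat" and n :: nat
  assumes "n \<ge> 2" and "A \<in> carrier_mat n n"
  shows "discrepancy_values A = singular_values A \<longleftrightarrow>
    (\<exists>U S V. is_SVD A U S V \<and> (\<forall>i<n. (mat_adjoint U * V) $$ (i, i) = 0))"
proof -
  let ?a = "\<lambda>l m. A $$ (l, m)"
  obtain u0 v0 s where svd0: "svd n ?a u0 s v0" and s: "nonneg_decr n s"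
    using svd_exists[of n ?a] unfolding svd_def nonneg_decr_def by metis
  \<comment> \<open>The list determines \<open>s\<close>, so every decomposition below has the same
    singular values in the same order.\<close>
  note sv = singular_values_eq[OF assms(2) svd0 s]
  have diag: "(mat_adjoint U * V) $$ (i, i) = cip n (\<lambda>l. V $$ (l, i)) (\<lambda>l. U $$ (l, i))"
    if "U \<in> carrier_mat n n" "V \<in> carrier_mat n n" "i < n" for U V i
    using adjoint_self_mult_index that by blast
  have "discrepancy_values A = singular_values A \<longleftrightarrow>
      (\<forall>k. 0 < k \<longrightarrow> k \<le> n \<longrightarrow> discrepancy_seminorm k A = (\<Sum>l<k. s l))"
    unfolding sv by (rule discrepancy_values_eq_iff[OF assms(2)])
  also have "\<dots> \<longleftrightarrow> (\<exists>u v. svd n ?a u s v \<and> (\<forall>i<n. cip n (v i) (u i) = 0))"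
  proof
    assume eq: "\<forall>k. 0 < k \<longrightarrow> k \<le> n \<longrightarrow> discrepancy_seminorm k A = (\<Sum>l<k. s l)"
    show "\<exists>u v. svd n ?a u s v \<and> (\<forall>i<n. cip n (v i) (u i) = 0)"
    proof (rule svd_zero_diagonal[OF svd0 s])
      fix k assume k: "0 < k" "k \<le> n"
      then show "\<exists>x y. ons n k x \<and> ons n k y \<and> traceless n k x y
          \<and> cmod (\<Sum>i<k. cip n (mv ?a n (x i)) (y i)) = (\<Sum>l<k. s l)"
        using eq discrepancy_seminorm_attained[OF assms(2,1) k] by metis
    qed (use assms(1) in simp)
  next
    assume "\<exists>u v. svd n ?a u s v \<and> (\<forall>i<n. cip n (v i) (u i) = 0)"
    then obtain u v where svd: "svd n ?a u s v" and zero: "\<And>i. i < n \<Longrightarrow> cip n (v i) (u i) = 0"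
      by blast
    show "\<forall>k. 0 < k \<longrightarrow> k \<le> n \<longrightarrow> discrepancy_seminorm k A = (\<Sum>l<k. s l)"
    proof (intro allI impI)
      fix k assume k: "0 < k" "k \<le> n"
      \<comment> \<open>The first \<open>k\<close> pairs \<open>v i\<close>, \<open>u i\<close> are
        admissible and attain Ky Fan's bound.\<close>
      have "Sup (discrepancy_set n k ?a) = (\<Sum>l<k. s l)"
      proof (rule cSup_eq_maximum)
        have ons: "ons n k u" "ons n k v" using svd k by (auto simp: svd_def ons_def)
        have "cip n (mv ?a n (v i)) (u i) = of_real (s i)" if "i < k" for i
        proof -
          have "cip n (mv ?a n (v i)) (u i) = cip n (\<lambda>l. of_real (s i) * u i l) (u i)"
            using svd that k by (intro cip_cong) (auto simp: svd_def)
          then show ?thesis using onsD[OF ons(1) that that] by (simp add: cip_linear)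
        qed
        then have "(\<Sum>i<k. cip n (mv ?a n (v i)) (u i)) = of_real (\<Sum>l<k. s l)" by simp
        moreover have "0 \<le> (\<Sum>l<k. s l)"
          using s k by (intro sum_nonneg) (auto simp: nonneg_decr_def)
        ultimately have "cmod (\<Sum>i<k. cip n (mv ?a n (v i)) (u i)) = (\<Sum>l<k. s l)"
          by (simp only: norm_of_real abs_of_nonneg)
        moreover have "traceless n k v u" using zero k by (simp add: traceless_def)
        ultimately show "(\<Sum>l<k. s l) \<in> discrepancy_set n k ?a"
          using ons unfolding discrepancy_set_def by force
      qed (use ky_fan_svd[OF svd s k(2)] in \<open>auto simp: discrepancy_set_def\<close>)
      then show "discrepancy_seminorm k A = (\<Sum>l<k. s l)"
        using discrepancy_seminorm_eq[OF assms(2) k(1)] by simp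
    qed
  qed
  also have "\<dots> \<longleftrightarrow> (\<exists>U S V. is_SVD A U S V \<and> (\<forall>i<n. (mat_adjoint U * V) $$ (i, i) = 0))"
  proof
    assume "\<exists>u v. svd n ?a u s v \<and> (\<forall>i<n. cip n (v i) (u i) = 0)"
    then obtain u v where svd: "svd n ?a u s v" and zero: "\<And>i. i < n \<Longrightarrow> cip n (v i) (u i) = 0"
      by blast
    define U where "U = Matrix.mat n n (\<lambda>(l, i). u i l)"
    define V where "V = Matrix.mat n n (\<lambda>(l, i). v i l)"
    have UV: "U \<in> carrier_mat n n" "V \<in> carrier_mat n n" by (auto simp: U_def V_def)
    have "svd n ?a (\<lambda>i l. U $$ (l, i)) s (\<lambda>i l. V $$ (l, i))"
      by (rule svd_cong[OF svd]) (auto simp: U_def V_def)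
    moreover have "cip n (\<lambda>l. V $$ (l, i)) (\<lambda>l. U $$ (l, i)) = cip n (v i) (u i)" if "i < n" for i
      using that by (intro cip_cong) (auto simp: U_def V_def)
    ultimately show "\<exists>U S V. is_SVD A U S V \<and> (\<forall>i<n. (mat_adjoint U * V) $$ (i, i) = 0)"
      using UV zero diag is_SVD_iff[OF assms(2) sv] by metis
  next
    assume "\<exists>U S V. is_SVD A U S V \<and> (\<forall>i<n. (mat_adjoint U * V) $$ (i, i) = 0)"
    then obtain U S V where "is_SVD A U S V" and zero: "\<And>i. i < n \<Longrightarrow> (mat_adjoint U * V) $$ (i, i) = 0"
      by blast
    then have "U \<in> carrier_mat n n" "V \<in> carrier_mat n n"
      and "svd n ?a (\<lambda>i l. U $$ (l, i)) s (\<lambda>i l. V $$ (l, i))"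
      using is_SVD_iff[OF assms(2) sv] by auto
    then show "\<exists>u v. svd n ?a u s v \<and> (\<forall>i<n. cip n (v i) (u i) = 0)"
      using diag zero by (intro exI conjI allI impI) auto
  qed
  finally show ?thesis .
qed

end
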